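(* Let $1<p,q,s<\infty$. The pair of real Banach spaces $(\ell_s \oplus_p \ell_p, \ell_s \oplus_q \ell_q)$ satisfies the WMP if and only if $p \leq s \leq q$.
   Context: $X\oplus_p Y$ denotes the direct sum with norm $\|(x,y)\|=(\|x\|^p+\|y\|^p)^{1/p}$. A bounded linear operator $T:E\to F$ attains its norm if there is $x_0$ in the unit sphere $S_E$ with $\|T(x_0)\|=\|T\|$. A maximizing sequence for $T$ is a sequence $(x_n)\subset S_E$ with $\|T(x_n)\|\to\|T\|$. A pair $(E,F)$ of Banach spaces has the weak maximizing property (WMP) if every bounded linear operator $T:E\to F$ that admits a non-weakly null maximizing sequence (i.e. one not converging weakly to $0$) attains its norm. *)

theory Defs
  imports "HOL-Analysis.Analysis" "HOL-Library.Function_Algebras"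
begin

text \<open>
  Sequence spaces depend on a real exponent and hence cannot be Isabelle types.  A real normed
  space is therefore given by a carrier set inside an ambient real vector space, together with
  a norm function; the vector space operations are those of the ambient type, and only the
  values of the norm on the carrier matter.  For scalar sequences the ambient vector space is
  the function type with pointwise operations.
\<close>

instantiation "fun" :: (type, real_vector) real_vector
begin

definition scaleR_fun_def: "c *\<^sub>R f = (\<lambda>x. c *\<^sub>R f x)"

instance
  by standard (simp_all add: scaleR_fun_def fun_eq_iff scaleR_add_right scaleR_add_left)

end

lemma scaleR_fun_apply [simp]: "(c *\<^sub>R f) x = c *\<^sub>R f x"
  by (simp add: scaleR_fun_def)

record 'a normed_space =
  vecs :: "'a set"
  vnorm :: "'a \<Rightarrow> real"

definition real_space :: "real normed_space" where
  "real_space = \<lparr>vecs = UNIV, vnorm = abs\<rparr>"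

definition ell :: "real \<Rightarrow> (nat \<Rightarrow> real) normed_space" where
  "ell p = \<lparr>vecs = {x. summable (\<lambda>n. \<bar>x n\<bar> powr p)},
            vnorm = (\<lambda>x. (\<Sum>n. \<bar>x n\<bar> powr p) powr (1 / p))\<rparr>"

definition direct_sum ::
  "real \<Rightarrow> 'a normed_space \<Rightarrow> 'b normed_space \<Rightarrow> ('a \<times> 'b) normed_space" where
  "direct_sum p X Y =
     \<lparr>vecs = vecs X \<times> vecs Y,
      vnorm = (\<lambda>(x, y). (vnorm X x powr p + vnorm Y y powr p) powr (1 / p))\<rparr>"

definition unit_sphere :: "'a normed_space \<Rightarrow> 'a set" where
  "unit_sphere E = {x \<in> vecs E. vnorm E x = 1}"

definition bounded_linear_op ::
  "'a::real_vector normed_space \<Rightarrow> 'b::real_vector normed_space \<Rightarrow> ('a \<Rightarrow> 'b) \<Rightarrow> bool" where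
  "bounded_linear_op E F T \<longleftrightarrow>
     (\<forall>x\<in>vecs E. T x \<in> vecs F) \<and>
     (\<forall>x\<in>vecs E. \<forall>y\<in>vecs E. T (x + y) = T x + T y) \<and>
     (\<forall>c. \<forall>x\<in>vecs E. T (c *\<^sub>R x) = c *\<^sub>R T x) \<and>
     (\<exists>K. \<forall>x\<in>vecs E. vnorm F (T x) \<le> K * vnorm E x)"

definition op_norm :: "'a normed_space \<Rightarrow> 'b normed_space \<Rightarrow> ('a \<Rightarrow> 'b) \<Rightarrow> real" where
  "op_norm E F T = (SUP x\<in>{x \<in> vecs E. vnorm E x \<le> 1}. vnorm F (T x))"

definition attains_norm :: "'a normed_space \<Rightarrow> 'b normed_space \<Rightarrow> ('a \<Rightarrow> 'b) \<Rightarrow> bool" where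
  "attains_norm E F T \<longleftrightarrow> (\<exists>x0\<in>unit_sphere E. vnorm F (T x0) = op_norm E F T)"

definition maximizing_seq ::
  "'a normed_space \<Rightarrow> 'b normed_space \<Rightarrow> ('a \<Rightarrow> 'b) \<Rightarrow> (nat \<Rightarrow> 'a) \<Rightarrow> bool" where
  "maximizing_seq E F T x \<longleftrightarrow>
     (\<forall>n. x n \<in> unit_sphere E) \<and> (\<lambda>n. vnorm F (T (x n))) \<longlonglongrightarrow> op_norm E F T"

definition weakly_null :: "'a::real_vector normed_space \<Rightarrow> (nat \<Rightarrow> 'a) \<Rightarrow> bool" where
  "weakly_null E x \<longleftrightarrow>
     (\<forall>\<phi>. bounded_linear_op E real_space \<phi> \<longrightarrow> (\<lambda>n. \<phi> (x n)) \<longlonglongrightarrow> 0)"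

definition weak_maximizing_property ::
  "'a::real_vector normed_space \<Rightarrow> 'b::real_vector normed_space \<Rightarrow> bool" where
  "weak_maximizing_property E F \<longleftrightarrow>
     (\<forall>T. bounded_linear_op E F T \<longrightarrow>
          (\<exists>x. maximizing_seq E F T x \<and> \<not> weakly_null E x) \<longrightarrow>
          attains_norm E F T)"

end

theory Submission
  imports Defs
begin

text \<open>
  If \<open>p \<le> s \<le> q\<close>, the domain satisfies a lower and the codomain an upper \<open>s\<close>-estimate along weakly
  null perturbations: after passing to a subsequence, a maximizing sequence that is not weakly
  null has the form \<open>z + w\<^sub>n\<close> with \<open>z \<noteq> 0\<close> and \<open>w\<^sub>n\<close> weakly null, and the Brezis--Lieb lemma in each
  \<open>\<ell>\<^sub>r\<close> together with Minkowski's inequality gives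
  \<open>\<parallel>z\<parallel>\<^sup>s + lim \<parallel>w\<^sub>n\<parallel>\<^sup>s \<le> 1\<close> and \<open>\<parallel>T\<parallel>\<^sup>s \<le> \<parallel>T z\<parallel>\<^sup>s + lim \<parallel>T w\<^sub>n\<parallel>\<^sup>s\<close>.
  Hence \<open>\<parallel>T\<parallel> \<parallel>z\<parallel> \<le> \<parallel>T z\<parallel>\<close>, so \<open>T\<close> attains its norm at \<open>z / \<parallel>z\<parallel>\<close>.

  If \<open>s < p\<close> or \<open>q < s\<close>, take \<open>T (a, x) = (a, D x)\<close> from \<open>\<real> \<oplus>\<^sub>\<alpha> \<ell>\<^sub>s\<close> to \<open>\<real> \<oplus>\<^sub>\<beta> \<ell>\<^sub>s\<close>, where \<open>\<beta> < \<alpha>\<close> and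
  \<open>D\<close> is a diagonal operator whose entries increase strictly to 1. As \<open>\<ell>\<^sub>s\<close> contains
  \<open>\<real> \<oplus>\<^sub>s \<ell>\<^sub>s\<close>, both cases are of this form, with \<open>(\<alpha>, \<beta>) = (p, s)\<close> and \<open>(s, q)\<close>. The supremum is
  approached only by vectors with both components of equal size, which \<open>D\<close> shrinks.
\<close>

section \<open>Scalar inequalities\<close>

lemma powr_le_imp_le_base:
  fixes x y r :: real
  assumes "x powr r \<le> y powr r" "0 < r" "0 \<le> y"
  shows "x \<le> y"
  using assms powr_less_mono2[of r y x] by (meson not_le)

text \<open>Convexity of the power function settles positive \<open>x\<close> and \<open>y\<close>.
  If one of them is 0, the claim reduces to
  \<open>(\<mu> * z) powr t \<le> \<mu> * z powr t\<close>, which holds because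
  \<open>\<mu> powr t \<le> \<mu>\<close> on [0, 1].\<close>

lemma powr_convex_nonneg:
  fixes t l x y :: real
  assumes "1 \<le> t" "0 \<le> l" "l \<le> 1" "0 \<le> x" "0 \<le> y"
  shows "(l * x + (1 - l) * y) powr t \<le> l * x powr t + (1 - l) * y powr t"
proof -
  have scale: "(\<mu> * z) powr t \<le> \<mu> * z powr t" if "0 \<le> \<mu>" "\<mu> \<le> 1" "0 \<le> z" for \<mu> z :: real
  proof -
    have "\<mu> powr t \<le> \<mu> powr 1"
      using that assms(1) by (intro powr_mono') auto
    then have "\<mu> powr t \<le> \<mu>" using that by simp
    then show ?thesis using that by (simp add: powr_mult mult_right_mono)
  qed
  show ?thesis
  proof (cases "x = 0 \<or> y = 0")
    case True
    then show ?thesis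
      using scale[of l x] scale[of "1 - l" y] assms by auto
  next
    case False
    then show ?thesis
      using convex_onD[OF powr_convex[OF assms(1)], of "1 - l" x y] assms by simp
  qed
qed

text \<open>Minkowski's inequality for the t-norm on the plane, by convexity after normalization: if
  u and v are the norms of (a, c) and (b, d), each coordinate of the sum is u + v times a convex
  combination of normalized coordinates with weights u / (u + v) and v / (u + v).\<close>

lemma Minkowski_powr_add:
  fixes a b c d t :: real
  assumes t: "1 \<le> t" and nonneg: "0 \<le> a" "0 \<le> b" "0 \<le> c" "0 \<le> d"
  shows "((a + b) powr t + (c + d) powr t) powr (1 / t)
    \<le> (a powr t + c powr t) powr (1 / t) + (b powr t + d powr t) powr (1 / t)"
proof -
  define u v where "u = (a powr t + c powr t) powr (1 / t)"
    and "v = (b powr t + d powr t) powr (1 / t)"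
  have ut: "u powr t = a powr t + c powr t" and vt: "v powr t = b powr t + d powr t"
    using t by (simp_all add: u_def v_def powr_powr)
  have "u \<ge> 0" "v \<ge> 0" by (simp_all add: u_def v_def)
  consider "u = 0" | "v = 0" | "u > 0" "v > 0"
    using \<open>u \<ge> 0\<close> \<open>v \<ge> 0\<close> by linarith
  then have "(a + b) powr t + (c + d) powr t \<le> (u + v) powr t"
  proof cases
    case 1
    then have "a powr t + c powr t = 0" using ut by simp
    then have "a = 0 \<and> c = 0" by (simp add: add_nonneg_eq_0_iff)
    then show ?thesis using 1 vt by simp
  next
    case 2
    then have "b powr t + d powr t = 0" using vt by simp
    then have "b = 0 \<and> d = 0" by (simp add: add_nonneg_eq_0_iff)
    then show ?thesis using 2 ut by simp
  next
    case 3
    define l where "l = u / (u + v)"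
    have l01: "0 \<le> l" "l \<le> 1" using 3 by (auto simp: l_def)
    have l': "1 - l = v / (u + v)" using 3 by (simp add: l_def field_simps)
    have key: "(x + y) powr t \<le> (u + v) powr t * (l * (x / u) powr t + (1 - l) * (y / v) powr t)"
      if "0 \<le> x" "0 \<le> y" for x y
    proof -
      have "l * (x / u) = x / (u + v)" "(1 - l) * (y / v) = y / (u + v)"
        unfolding l' using 3 by (simp_all add: l_def)
      then have "x + y = (u + v) * (l * (x / u) + (1 - l) * (y / v))"
        using 3 by (simp flip: add_divide_distrib)
      then have "(x + y) powr t = (u + v) powr t * (l * (x / u) + (1 - l) * (y / v)) powr t"
        by (metis powr_mult)
      also have "\<dots> \<le> (u + v) powr t * (l * (x / u) powr t + (1 - l) * (y / v) powr t)"
        using that 3 l01 t by (intro mult_left_mono powr_convex_nonneg) auto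
      finally show ?thesis .
    qed
    \<comment> \<open>Both normalized vectors have t-norm 1, so adding \<open>key\<close> over the
      two coordinates leaves the total weight \<open>l + (1 - l) = 1\<close>.\<close>
    have norm1: "(x / w) powr t + (y / w) powr t = 1"
      if "w powr t = x powr t + y powr t" "0 < w" for x y w
    proof -
      have "w powr t \<noteq> 0" using that(2) by simp
      then have "w powr t / w powr t = 1" by (rule divide_self)
      then show ?thesis
        by (simp only: powr_divide that(1) add_divide_distrib)
    qed
    have "l * X + (1 - l) * Y + (l * Z + (1 - l) * V) = 1" if "X + Z = 1" "Y + V = 1" for X Y Z V
      using that by algebra
    from this[OF norm1[OF ut 3(1)] norm1[OF vt 3(2)]]
    have "l * (a / u) powr t + (1 - l) * (b / v) powr t
        + (l * (c / u) powr t + (1 - l) * (d / v) powr t) = 1" .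
    then have "(u + v) powr t * (l * (a / u) powr t + (1 - l) * (b / v) powr t)
        + (u + v) powr t * (l * (c / u) powr t + (1 - l) * (d / v) powr t) = (u + v) powr t"
      by (simp flip: distrib_left)
    then show ?thesis
      using key[of a b] key[of c d] nonneg by linarith
  qed
  then have "((a + b) powr t + (c + d) powr t) powr (1 / t) \<le> ((u + v) powr t) powr (1 / t)"
    using t by (intro powr_mono2) auto
  also have "\<dots> = u + v"
    using t \<open>u \<ge> 0\<close> \<open>v \<ge> 0\<close> by (simp add: powr_powr)
  finally show ?thesis by (simp add: u_def v_def)
qed

text \<open>Minkowski's inequality for the vectors (x, 0) and (0, y).\<close>

lemma powr_superadditive:
  fixes x y t :: real
  assumes "1 \<le> t" "0 \<le> x" "0 \<le> y"
  shows "x powr t + y powr t \<le> (x + y) powr t"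
proof -
  have "(x powr t + y powr t) powr (1 / t) \<le> (x powr t) powr (1 / t) + (y powr t) powr (1 / t)"
    using Minkowski_powr_add[of t x 0 0 y] assms by simp
  also have "\<dots> = x + y"
    using assms by (simp add: powr_powr)
  finally have "((x powr t + y powr t) powr (1 / t)) powr t \<le> (x + y) powr t"
    using assms by (intro powr_mono2) auto
  then show ?thesis using assms by (simp add: powr_powr)
qed

text \<open>\<open>A\<close>, \<open>B\<close> stand for s-th powers of first components and
  \<open>C\<close>, \<open>D\<close> for q-th powers of second components, so each term is the s-th
  power of a codomain norm. With t = q / s, superadditivity bounds \<open>C + D\<close>, and
  Minkowski applies to the vectors \<open>(A, C powr (1 / t))\<close> and
  \<open>(B, D powr (1 / t))\<close>.\<close>

lemma upper_estimate:
  fixes A B C D q s :: real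
  assumes "0 < s" "s \<le> q" "0 \<le> A" "0 \<le> B" "0 \<le> C" "0 \<le> D"
  shows "((A + B) powr (q / s) + (C + D)) powr (s / q)
    \<le> (A powr (q / s) + C) powr (s / q) + (B powr (q / s) + D) powr (s / q)"
proof -
  define t where "t = q / s"
  have t: "1 \<le> t" and it: "s / q = 1 / t" using assms by (simp_all add: t_def)
  have C: "(C powr (1 / t)) powr t = C" and D: "(D powr (1 / t)) powr t = D"
    using t assms by (simp_all add: powr_powr)
  have "C + D \<le> (C powr (1 / t) + D powr (1 / t)) powr t"
    using powr_superadditive[of t "C powr (1 / t)" "D powr (1 / t)"] t C D by simp
  then have "((A + B) powr t + (C + D)) powr (1 / t)
      \<le> ((A + B) powr t + (C powr (1 / t) + D powr (1 / t)) powr t) powr (1 / t)"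
    using t assms by (intro powr_mono2) auto
  also have "\<dots> \<le> (A powr t + C) powr (1 / t) + (B powr t + D) powr (1 / t)"
    using Minkowski_powr_add[of t A B "C powr (1 / t)" "D powr (1 / t)"] t C D assms by simp
  finally show ?thesis unfolding it t_def[symmetric] .
qed

text \<open>Now t = s / p, and the vectors are grouped by component of the direct sum: Minkowski is
  applied to \<open>(a, b)\<close> and \<open>(C, D)\<close>, and superadditivity bounds the t-norm
  of the latter by \<open>C + D\<close>.\<close>

lemma lower_estimate:
  fixes A B C D p s :: real
  assumes "0 < p" "p \<le> s" "0 \<le> A" "0 \<le> B" "0 \<le> C" "0 \<le> D"
  shows "(A powr (p / s) + C) powr (s / p) + (B powr (p / s) + D) powr (s / p)
    \<le> ((A + B) powr (p / s) + (C + D)) powr (s / p)"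
proof -
  define t where "t = s / p"
  define a b where "a = A powr (1 / t)" and "b = B powr (1 / t)"
  have t: "1 \<le> t" and it: "p / s = 1 / t" using assms by (simp_all add: t_def)
  have at: "a powr t = A" and bt: "b powr t = B" and ab: "0 \<le> a" "0 \<le> b"
    using t assms by (simp_all add: powr_powr a_def b_def)
  have "((a + C) powr t + (b + D) powr t) powr (1 / t)
      \<le> (A + B) powr (1 / t) + (C powr t + D powr t) powr (1 / t)"
    using Minkowski_powr_add[of t a C b D] t ab assms at bt by simp
  also have "(C powr t + D powr t) powr (1 / t) \<le> ((C + D) powr t) powr (1 / t)"
    using t assms by (intro powr_mono2 powr_superadditive) auto
  also have "((C + D) powr t) powr (1 / t) = C + D"
    using t assms by (simp add: powr_powr)
  finally have "(((a + C) powr t + (b + D) powr t) powr (1 / t)) powr t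
      \<le> ((A + B) powr (1 / t) + (C + D)) powr t"
    using t by (intro powr_mono2) auto
  then show ?thesis
    unfolding it t_def[symmetric] a_def[symmetric] b_def[symmetric] using t by (simp add: powr_powr)
qed

text \<open>Midpoint convexity of the power \<alpha> / \<beta> at the points
  \<open>a powr \<beta>\<close> and \<open>b powr \<beta>\<close>. The bound is the value at
  \<open>a = b = 2 powr (- 1 / \<alpha>)\<close>.\<close>

lemma power_mean_le:
  fixes a b \<alpha> \<beta> :: real
  assumes "0 < \<beta>" "\<beta> \<le> \<alpha>" "0 \<le> a" "0 \<le> b" "a powr \<alpha> + b powr \<alpha> \<le> 1"
  shows "a powr \<beta> + b powr \<beta> \<le> 2 powr (1 - \<beta> / \<alpha>)"
proof -
  define t where "t = \<alpha> / \<beta>"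
  have t: "1 \<le> t" "\<beta> * t = \<alpha>" "\<beta> / \<alpha> = 1 / t" using assms by (simp_all add: t_def)
  have "((a powr \<beta> + b powr \<beta>) / 2) powr t \<le> (a powr \<alpha> + b powr \<alpha>) / 2"
    using powr_convex_nonneg[of t "1/2" "a powr \<beta>" "b powr \<beta>"] t
    by (simp add: powr_powr add_divide_distrib)
  also have "\<dots> \<le> 1 / 2" using assms by simp
  finally have "(((a powr \<beta> + b powr \<beta>) / 2) powr t) powr (1 / t) \<le> (1 / 2) powr (1 / t)"
    using t by (intro powr_mono2) auto
  then have "(a powr \<beta> + b powr \<beta>) / 2 \<le> (1 / 2) powr (1 / t)"
    using t by (simp add: powr_powr)
  also have "\<dots> = 2 powr (- 1 / t)"
    by (simp add: powr_divide powr_minus_divide)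
  finally have "a powr \<beta> + b powr \<beta> \<le> 2 * 2 powr (- 1 / t)" by simp
  also have "\<dots> = 2 powr (1 - \<beta> / \<alpha>)"
    unfolding t(3) by (simp add: powr_diff powr_minus_divide)
  finally show ?thesis .
qed

text \<open>Strictness comes from \<open>c < b\<close>. In the exceptional case
  \<open>b = c = 0\<close> only \<open>a powr \<beta> \<le> 1\<close> remains, and \<beta> <
  \<alpha> makes the bound exceed 1.\<close>

lemma power_mean_less:
  fixes a b c \<alpha> \<beta> :: real
  assumes "0 < \<beta>" "\<beta> < \<alpha>" "0 \<le> a" "0 \<le> b" "0 \<le> c" "a powr \<alpha> + b powr \<alpha> \<le> 1"
    and "c < b \<or> b = 0 \<and> c = 0"
  shows "a powr \<beta> + c powr \<beta> < 2 powr (1 - \<beta> / \<alpha>)"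
  using assms(7)
proof
  assume "c < b"
  then have "c powr \<beta> < b powr \<beta>" using assms by (intro powr_less_mono2) auto
  then show ?thesis using power_mean_le[of \<beta> \<alpha> a b] assms by linarith
next
  assume *: "b = 0 \<and> c = 0"
  have "(a powr \<alpha>) powr (\<beta> / \<alpha>) \<le> 1 powr (\<beta> / \<alpha>)"
    using assms * by (intro powr_mono2) auto
  then have "a powr \<beta> \<le> 1" using assms by (simp add: powr_powr)
  moreover have "1 < 2 powr (1 - \<beta> / \<alpha>)" using assms by simp
  ultimately show ?thesis using * by simp
qed

text \<open>If a is small relative to b, continuity of \<open>\<bar>1 + t\<bar> powr r\<close> at 0,
  scaled by \<open>\<bar>b\<bar> powr r\<close>, gives the \<epsilon> term. Otherwise b is at most a
  multiple of a, and the term with C absorbs both powers.\<close>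

lemma Brezis_Lieb_pointwise:
  fixes r \<epsilon> :: real
  assumes r: "0 < r" and e: "0 < \<epsilon>"
  obtains C where "0 \<le> C"
    "\<And>a b :: real. \<bar>\<bar>a + b\<bar> powr r - \<bar>b\<bar> powr r\<bar> \<le> \<epsilon> * \<bar>b\<bar> powr r + C * \<bar>a\<bar> powr r"
proof -
  have "((\<lambda>t::real. \<bar>1 + t\<bar> powr r) \<longlongrightarrow> \<bar>1 + 0\<bar> powr r) (at 0)"
    by (intro tendsto_intros) auto
  then obtain \<delta> where d: "0 < \<delta>"
    and dt: "\<And>t::real. t \<noteq> 0 \<Longrightarrow> \<bar>t\<bar> < \<delta> \<Longrightarrow> \<bar>\<bar>1 + t\<bar> powr r - 1\<bar> < \<epsilon>"
    using e unfolding LIM_eq by (auto simp: dest: spec[of _ \<epsilon>])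
  \<comment> \<open>In the second case \<open>\<bar>b\<bar> \<le> \<bar>a\<bar> / \<delta>\<close>,
    so \<open>\<bar>a + b\<bar>\<close> and \<open>\<bar>b\<bar>\<close> are both at most
    \<open>(1 + 1 / \<delta>) * \<bar>a\<bar>\<close>.\<close>
  define C where "C = (1 + 1 / \<delta>) powr r"
  have "\<bar>\<bar>a + b\<bar> powr r - \<bar>b\<bar> powr r\<bar> \<le> \<epsilon> * \<bar>b\<bar> powr r + C * \<bar>a\<bar> powr r" for a b :: real
  proof (cases "\<bar>a\<bar> < \<delta> * \<bar>b\<bar>")
    case True
    then have b: "b \<noteq> 0" using d by auto
    have t: "\<bar>a / b\<bar> < \<delta>" using True b by (simp add: field_simps abs_divide)
    have "\<bar>\<bar>1 + a / b\<bar> powr r - 1\<bar> \<le> \<epsilon>"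
      using less_imp_le[OF dt[of "a / b", OF _ t]] e b by (cases "a = 0") simp_all
    then have "\<bar>b\<bar> powr r * \<bar>\<bar>1 + a / b\<bar> powr r - 1\<bar> \<le> \<bar>b\<bar> powr r * \<epsilon>"
      by (intro mult_left_mono) auto
    moreover have "\<bar>b\<bar> powr r * \<bar>\<bar>1 + a / b\<bar> powr r - 1\<bar>
        = \<bar>(\<bar>b\<bar> * \<bar>1 + a / b\<bar>) powr r - \<bar>b\<bar> powr r\<bar>"
      by (simp add: powr_mult abs_mult right_diff_distrib flip: abs_mult_pos)
         (metis abs_mult abs_of_nonneg mult.right_neutral powr_ge_zero right_diff_distrib)
    moreover have "\<bar>b\<bar> * \<bar>1 + a / b\<bar> = \<bar>a + b\<bar>"
      using b by (simp add: field_simps flip: abs_mult)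
    moreover have "0 \<le> C * \<bar>a\<bar> powr r" by (simp add: C_def)
    ultimately show ?thesis by (simp add: mult.commute)
  next
    case False
    then have b: "\<bar>b\<bar> \<le> \<bar>a\<bar> / \<delta>" using d by (simp add: field_simps)
    have "\<bar>a + b\<bar> \<le> (1 + 1 / \<delta>) * \<bar>a\<bar>" "\<bar>b\<bar> \<le> (1 + 1 / \<delta>) * \<bar>a\<bar>"
      using b abs_triangle_ineq[of a b] by (auto simp: distrib_right)
    then have "\<bar>a + b\<bar> powr r \<le> ((1 + 1 / \<delta>) * \<bar>a\<bar>) powr r"
      "\<bar>b\<bar> powr r \<le> ((1 + 1 / \<delta>) * \<bar>a\<bar>) powr r"
      using r by (auto intro!: powr_mono2)
    moreover have "((1 + 1 / \<delta>) * \<bar>a\<bar>) powr r = C * \<bar>a\<bar> powr r"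
      using d by (simp add: C_def powr_mult)
    moreover have "0 \<le> \<epsilon> * \<bar>b\<bar> powr r" using e by simp
    ultimately show ?thesis
      by (smt (verit) powr_ge_zero)
  qed
  moreover have "0 \<le> C" by (simp add: C_def)
  ultimately show ?thesis using that by blast
qed

section \<open>The spaces \<open>\<ell>\<^sub>r\<close>\<close>

text \<open>The r-th power of the norm. Without the root, disjoint supports and the Brezis-Lieb
  limit give exact additivity.\<close>

definition power_sum :: "real \<Rightarrow> (nat \<Rightarrow> real) \<Rightarrow> real" where
  "power_sum r x = (\<Sum>n. \<bar>x n\<bar> powr r)"

lemma mem_ell: "x \<in> vecs (ell r) \<longleftrightarrow> summable (\<lambda>n. \<bar>x n\<bar> powr r)"
  by (simp add: ell_def)

lemma vnorm_ell: "vnorm (ell r) x = power_sum r x powr (1 / r)"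
  by (simp add: ell_def power_sum_def)

lemma power_sum_nonneg: "x \<in> vecs (ell r) \<Longrightarrow> 0 \<le> power_sum r x"
  by (simp add: mem_ell power_sum_def suminf_nonneg)

lemma coordinate_powr_le_power_sum:
  assumes "x \<in> vecs (ell r)"
  shows "\<bar>x k\<bar> powr r \<le> power_sum r x"
  using sum_le_suminf[of "\<lambda>n. \<bar>x n\<bar> powr r" "{k}"] assms by (simp add: mem_ell power_sum_def)

lemma abs_coordinate_le_vnorm_ell:
  assumes "0 < r" "x \<in> vecs (ell r)"
  shows "\<bar>x k\<bar> \<le> vnorm (ell r) x"
proof -
  have "(\<bar>x k\<bar> powr r) powr (1 / r) \<le> power_sum r x powr (1 / r)"
    using assms by (intro powr_mono2 coordinate_powr_le_power_sum) auto
  then show ?thesis using assms by (simp add: powr_powr vnorm_ell)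
qed

lemma power_sum_eq_0_imp:
  assumes "x \<in> vecs (ell r)" "power_sum r x = 0"
  shows "x = 0"
  using assms suminf_eq_zero_iff[of "\<lambda>n. \<bar>x n\<bar> powr r"]
  by (auto simp: mem_ell power_sum_def fun_eq_iff)

lemma ell_dominated:
  assumes "0 < r" "x \<in> vecs (ell r)" "\<And>k. \<bar>y k\<bar> \<le> \<bar>x k\<bar>"
  shows "y \<in> vecs (ell r)" "power_sum r y \<le> power_sum r x"
proof -
  have le: "\<bar>y k\<bar> powr r \<le> \<bar>x k\<bar> powr r" for k
    using assms by (intro powr_mono2) auto
  show y: "y \<in> vecs (ell r)"
    unfolding mem_ell
    by (rule summable_comparison_test'[of "\<lambda>n. \<bar>x n\<bar> powr r" 0]) (use assms le in \<open>auto simp: mem_ell\<close>)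
  show "power_sum r y \<le> power_sum r x"
    unfolding power_sum_def using y assms le by (intro suminf_le) (auto simp: mem_ell)
qed

lemma ell_scale:
  assumes "x \<in> vecs (ell r)"
  shows "c *\<^sub>R x \<in> vecs (ell r)" "power_sum r (c *\<^sub>R x) = \<bar>c\<bar> powr r * power_sum r x"
  using assms by (simp_all add: mem_ell power_sum_def abs_mult powr_mult summable_mult suminf_mult)

lemma ell_zero: "0 \<in> vecs (ell r)" "power_sum r 0 = 0"
  by (simp_all add: mem_ell power_sum_def)

text \<open>A crude bound from \<open>\<bar>x k + y k\<bar> \<le> 2 * max \<bar>x k\<bar> \<bar>y
  k\<bar>\<close>. It serves for membership and for boundedness of sequences, where the constant
  does not matter.\<close>

lemma ell_add:
  assumes "0 < r" "x \<in> vecs (ell r)" "y \<in> vecs (ell r)"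
  shows "x + y \<in> vecs (ell r)"
    "power_sum r (x + y) \<le> 2 powr r * (power_sum r x + power_sum r y)"
proof -
  have le: "\<bar>x k + y k\<bar> powr r \<le> 2 powr r * (\<bar>x k\<bar> powr r + \<bar>y k\<bar> powr r)" for k
  proof -
    have "\<bar>x k + y k\<bar> powr r \<le> (2 * max \<bar>x k\<bar> \<bar>y k\<bar>) powr r"
      using assms by (intro powr_mono2) auto
    also have "\<dots> = 2 powr r * max \<bar>x k\<bar> \<bar>y k\<bar> powr r" by (simp add: powr_mult)
    also have "max \<bar>x k\<bar> \<bar>y k\<bar> powr r \<le> \<bar>x k\<bar> powr r + \<bar>y k\<bar> powr r"
      by (simp add: max_def)
    finally show ?thesis by simp
  qed
  have sm: "summable (\<lambda>k. 2 powr r * (\<bar>x k\<bar> powr r + \<bar>y k\<bar> powr r))"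
    using assms by (intro summable_mult summable_add) (auto simp: mem_ell)
  show xy: "x + y \<in> vecs (ell r)"
    unfolding mem_ell by (rule summable_comparison_test'[OF sm, of 0]) (use le in auto)
  have "power_sum r (x + y) \<le> (\<Sum>k. 2 powr r * (\<bar>x k\<bar> powr r + \<bar>y k\<bar> powr r))"
    unfolding power_sum_def using xy le sm by (intro suminf_le) (auto simp: mem_ell)
  also have "\<dots> = 2 powr r * (power_sum r x + power_sum r y)"
    using assms by (simp add: mem_ell power_sum_def suminf_mult summable_add suminf_add)
  finally show "power_sum r (x + y) \<le> 2 powr r * (power_sum r x + power_sum r y)" .
qed

lemma ell_diff:
  assumes "0 < r" "x \<in> vecs (ell r)" "y \<in> vecs (ell r)"
  shows "x - y \<in> vecs (ell r)"
    "power_sum r (x - y) \<le> 2 powr r * (power_sum r x + power_sum r y)"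
  using ell_add[OF assms(1,2) ell_scale(1)[OF assms(3), of "-1"]] ell_scale(2)[OF assms(3), of "-1"]
  by simp_all

lemma power_sum_disjoint_add:
  assumes "x \<in> vecs (ell r)" "y \<in> vecs (ell r)" "\<And>k. x k = 0 \<or> y k = 0"
  shows "power_sum r (x + y) = power_sum r x + power_sum r y"
proof -
  have "\<bar>x k + y k\<bar> powr r = \<bar>x k\<bar> powr r + \<bar>y k\<bar> powr r" for k
    using assms(3)[of k] by auto
  then show ?thesis
    using assms by (simp add: power_sum_def mem_ell suminf_add)
qed

section \<open>Initial segments and remainders of sequences\<close>

definition trunc :: "nat \<Rightarrow> (nat \<Rightarrow> real) \<Rightarrow> nat \<Rightarrow> real" where
  "trunc N x = (\<lambda>k. if k < N then x k else 0)"

definition remainder :: "nat \<Rightarrow> (nat \<Rightarrow> real) \<Rightarrow> nat \<Rightarrow> real" where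
  "remainder N x = (\<lambda>k. if k < N then 0 else x k)"

lemma trunc_add_remainder: "trunc N x + remainder N x = x"
  by (auto simp: trunc_def remainder_def fun_eq_iff)

lemma trunc_ell: "0 < r \<Longrightarrow> x \<in> vecs (ell r) \<Longrightarrow> trunc N x \<in> vecs (ell r)"
  and power_sum_trunc_le: "0 < r \<Longrightarrow> x \<in> vecs (ell r) \<Longrightarrow> power_sum r (trunc N x) \<le> power_sum r x"
  and remainder_ell: "0 < r \<Longrightarrow> x \<in> vecs (ell r) \<Longrightarrow> remainder N x \<in> vecs (ell r)"
  and power_sum_remainder_le:
    "0 < r \<Longrightarrow> x \<in> vecs (ell r) \<Longrightarrow> power_sum r (remainder N x) \<le> power_sum r x"
  by (rule ell_dominated; force simp: trunc_def remainder_def)+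

lemma power_sum_trunc: "power_sum r (trunc N x) = (\<Sum>k<N. \<bar>x k\<bar> powr r)"
  unfolding power_sum_def by (subst suminf_finite[of "{..<N}"]) (auto simp: trunc_def)

lemma power_sum_remainder_tendsto:
  assumes "0 < r" "x \<in> vecs (ell r)"
  shows "(\<lambda>N. power_sum r (remainder N x)) \<longlonglongrightarrow> 0"
proof -
  have "power_sum r (remainder N x) = power_sum r x - (\<Sum>k<N. \<bar>x k\<bar> powr r)" for N
    using power_sum_disjoint_add[OF trunc_ell[OF assms] remainder_ell[OF assms], of N N]
    by (simp add: trunc_add_remainder power_sum_trunc[symmetric]) (simp add: trunc_def remainder_def)
  moreover have "(\<lambda>N. \<Sum>k<N. \<bar>x k\<bar> powr r) \<longlonglongrightarrow> power_sum r x"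
    using assms summable_LIMSEQ by (auto simp: mem_ell power_sum_def)
  then have "(\<lambda>N. power_sum r x - (\<Sum>k<N. \<bar>x k\<bar> powr r)) \<longlonglongrightarrow> power_sum r x - power_sum r x"
    by (intro tendsto_intros)
  ultimately show ?thesis by simp
qed

section \<open>Bounded operators, and functionals on ell_r\<close>

lemma bounded_linear_op_mem: "bounded_linear_op E F T \<Longrightarrow> x \<in> vecs E \<Longrightarrow> T x \<in> vecs F"
  and bounded_linear_op_add:
    "bounded_linear_op E F T \<Longrightarrow> x \<in> vecs E \<Longrightarrow> y \<in> vecs E \<Longrightarrow> T (x + y) = T x + T y"
  and bounded_linear_op_scale:
    "bounded_linear_op E F T \<Longrightarrow> x \<in> vecs E \<Longrightarrow> T (c *\<^sub>R x) = c *\<^sub>R T x"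
  by (simp_all add: bounded_linear_op_def)

lemma bounded_linear_op_bound:
  assumes "bounded_linear_op E F T" "\<And>x. x \<in> vecs E \<Longrightarrow> 0 \<le> vnorm E x"
  obtains K where "0 \<le> K" "\<And>x. x \<in> vecs E \<Longrightarrow> vnorm F (T x) \<le> K * vnorm E x"
proof -
  have "\<exists>K. \<forall>x\<in>vecs E. vnorm F (T x) \<le> K * vnorm E x"
    using assms(1) unfolding bounded_linear_op_def by (elim conjE)
  then obtain K where K: "\<And>x. x \<in> vecs E \<Longrightarrow> vnorm F (T x) \<le> K * vnorm E x"
    by blast
  have "vnorm F (T x) \<le> \<bar>K\<bar> * vnorm E x" if "x \<in> vecs E" for x
    using K[OF that] mult_right_mono[OF abs_ge_self[of K] assms(2)[OF that]] by linarith
  then show ?thesis using that[of "\<bar>K\<bar>"] by simp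
qed

lemma ell_functional_bound:
  assumes "bounded_linear_op (ell r) real_space \<phi>"
  obtains K where "0 \<le> K" "\<And>x. x \<in> vecs (ell r) \<Longrightarrow> \<bar>\<phi> x\<bar> \<le> K * power_sum r x powr (1 / r)"
  by (rule bounded_linear_op_bound[OF assms]) (auto simp: vnorm_ell real_space_def)

text \<open>Otherwise one could add up \<open>m\<close> disjoint blocks on each of which the functional exceeds
  \<open>\<epsilon>\<close>: its value on the sum is at least \<open>m \<epsilon>\<close>, whereas the norm of the sum is only
  of order \<open>m\<close> to the power \<open>1 / r\<close>.\<close>

lemma ell_functional_small_on_remainders:
  fixes \<epsilon> W :: real
  assumes r: "1 < r" and \<phi>: "bounded_linear_op (ell r) real_space \<phi>"
    and e: "0 < \<epsilon>" and W: "0 \<le> W"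
  shows "\<exists>N. \<forall>x\<in>vecs (ell r). (\<forall>k<N. x k = 0) \<longrightarrow> power_sum r x \<le> W \<longrightarrow> \<bar>\<phi> x\<bar> \<le> \<epsilon>"
proof (rule ccontr)
  assume neg: "\<not> ?thesis"
  have r0: "0 < r" using r by simp
  obtain K where K: "0 \<le> K"
    and bd: "\<And>x. x \<in> vecs (ell r) \<Longrightarrow> \<bar>\<phi> x\<bar> \<le> K * power_sum r x powr (1 / r)"
    using ell_functional_bound[OF \<phi>] by blast
  have block: "\<exists>x M. x \<in> vecs (ell r) \<and> (\<forall>k. x k \<noteq> 0 \<longrightarrow> N \<le> k \<and> k < M)
      \<and> power_sum r x \<le> W \<and> \<epsilon> < \<phi> x" for N
  proof -
    obtain x where x: "x \<in> vecs (ell r)" "\<forall>k<N. x k = 0" "power_sum r x \<le> W" "\<epsilon> < \<bar>\<phi> x\<bar>"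
      using neg by (auto simp: not_le)
    \<comment> \<open>The sign makes \<phi> positive on the block, so that the values on several
      blocks add up without cancellation.\<close>
    define y where "y = sgn (\<phi> x) *\<^sub>R x"
    have y: "y \<in> vecs (ell r)" and y0: "\<forall>k<N. y k = 0" and \<phi>y: "\<epsilon> < \<phi> y"
      using x ell_scale[OF x(1)] bounded_linear_op_scale[OF \<phi> x(1)]
      by (auto simp: y_def sgn_if split: if_splits)
    have "sgn (\<phi> x) = 1 \<or> sgn (\<phi> x) = -1" using x(4) e by (auto simp: sgn_if)
    then have yW: "power_sum r y \<le> W"
      using x(3) ell_scale(2)[OF x(1)] by (auto simp: y_def)
    \<comment> \<open>On the remainders \<phi> tends to 0, so a long truncation still has value
      above \<epsilon>. Its finite support leaves room for the next disjoint block.\<close>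
    have "(\<lambda>M. K * power_sum r (remainder M y) powr (1 / r)) \<longlonglongrightarrow> K * 0 powr (1 / r)"
      using r0 y power_sum_nonneg[OF remainder_ell[OF r0 y]]
      by (intro tendsto_intros tendsto_powr' power_sum_remainder_tendsto) auto
    then have "eventually (\<lambda>M. K * power_sum r (remainder M y) powr (1 / r) < \<phi> y - \<epsilon>) sequentially"
      using \<phi>y by (intro order_tendstoD(2)) auto
    then obtain M where M: "K * power_sum r (remainder M y) powr (1 / r) < \<phi> y - \<epsilon>"
      by (auto simp: eventually_sequentially)
    have "\<phi> (trunc M y) + \<phi> (remainder M y) = \<phi> y"
      using bounded_linear_op_add[OF \<phi> trunc_ell[OF r0 y] remainder_ell[OF r0 y], of M M]
      by (simp add: trunc_add_remainder)
    then have "\<epsilon> < \<phi> (trunc M y)"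
      using bd[OF remainder_ell[OF r0 y], of M] M by linarith
    moreover have "N \<le> k \<and> k < M" if "trunc M y k \<noteq> 0" for k
    proof -
      have "k < M" "y k \<noteq> 0" using that by (auto simp: trunc_def split: if_splits)
      moreover have "\<not> k < N" using y0 \<open>y k \<noteq> 0\<close> by blast
      ultimately show ?thesis by simp
    qed
    moreover have "power_sum r (trunc M y) \<le> W"
      using power_sum_trunc_le[OF r0 y] yW by (rule order_trans)
    ultimately show ?thesis using trunc_ell[OF r0 y] by blast
  qed
  have blocks: "\<exists>x M. x \<in> vecs (ell r) \<and> (\<forall>k. x k \<noteq> 0 \<longrightarrow> k < M)
      \<and> power_sum r x \<le> real m * W \<and> real m * \<epsilon> \<le> \<phi> x" for m
  proof (induction m)
    case 0
    have "\<phi> 0 = 0" using bounded_linear_op_scale[OF \<phi> ell_zero(1), of 0] by simp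
    then have "(0 :: nat \<Rightarrow> real) \<in> vecs (ell r) \<and> (\<forall>k. (0 :: nat \<Rightarrow> real) k \<noteq> 0 \<longrightarrow> k < 0)
        \<and> power_sum r 0 \<le> real 0 * W \<and> real 0 * \<epsilon> \<le> \<phi> 0"
      by (simp add: ell_zero)
    then show ?case by (intro exI)
  next
    case (Suc m)
    then obtain x M where x: "x \<in> vecs (ell r)" "\<forall>k. x k \<noteq> 0 \<longrightarrow> k < M"
      "power_sum r x \<le> real m * W" "real m * \<epsilon> \<le> \<phi> x" by blast
    obtain y M' where y: "y \<in> vecs (ell r)" "\<forall>k. y k \<noteq> 0 \<longrightarrow> M \<le> k \<and> k < M'"
      "power_sum r y \<le> W" "\<epsilon> < \<phi> y" using block[of M] by blast
    have "power_sum r (x + y) = power_sum r x + power_sum r y"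
      using x(2) y(2) by (intro power_sum_disjoint_add x(1) y(1)) (meson not_less)
    then have "power_sum r (x + y) \<le> real (Suc m) * W"
      using x(3) y(3) by (simp add: distrib_right)
    moreover have "real (Suc m) * \<epsilon> \<le> \<phi> (x + y)"
      using x(4) y(4) bounded_linear_op_add[OF \<phi> x(1) y(1)] by (simp add: distrib_right)
    moreover have "\<forall>k. (x + y) k \<noteq> 0 \<longrightarrow> k < max M M'"
      using x(2) y(2) by (metis add.right_neutral less_max_iff_disj plus_fun_apply)
    ultimately show ?case using ell_add(1)[OF r0 x(1) y(1)] by blast
  qed
  \<comment> \<open>The norm bound at the sum of m blocks, divided by m.\<close>
  have le: "\<epsilon> \<le> K * W powr (1 / r) * real m powr (1 / r - 1)" if m: "0 < m" for m
  proof -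
    obtain x where x: "x \<in> vecs (ell r)" "power_sum r x \<le> real m * W" "real m * \<epsilon> \<le> \<phi> x"
      using blocks[of m] by blast
    have "real m * \<epsilon> \<le> K * power_sum r x powr (1 / r)" using bd[OF x(1)] x(3) by linarith
    also have "\<dots> \<le> K * (real m * W) powr (1 / r)"
      using x r0 K power_sum_nonneg[OF x(1)] by (intro mult_left_mono powr_mono2) auto
    also have "\<dots> = real m * (K * W powr (1 / r) * real m powr (1 / r - 1))"
    proof -
      have "real m powr (1 / r) = real m * real m powr (1 / r - 1)"
        using powr_mult_base[of "real m" "1 / r - 1"] by simp
      then show ?thesis by (simp add: powr_mult)
    qed
    finally show ?thesis using m by simp
  qed
  \<comment> \<open>Since \<open>1 < r\<close>, the exponent of m is negative and the bound on
    \<epsilon> tends to 0.\<close>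
  have "(\<lambda>m. K * W powr (1 / r) * real m powr (1 / r - 1)) \<longlonglongrightarrow> K * W powr (1 / r) * 0"
    using r by (intro tendsto_intros tendsto_neg_powr filterlim_real_sequentially) auto
  then have "eventually (\<lambda>m. K * W powr (1 / r) * real m powr (1 / r - 1) < \<epsilon>) sequentially"
    using e by (intro order_tendstoD(2)) auto
  then have "eventually (\<lambda>m::nat. False) sequentially"
    using eventually_gt_at_top[of 0]
  proof eventually_elim
    case (elim m)
    then show ?case using le[of m] by simp
  qed
  then show False by simp
qed

text \<open>Bounded sequences that tend to 0 in each coordinate are weakly null: beyond some N the
  remainders contribute at most e / 2 uniformly in n, and the first N coordinates tend to 0 jointly,
  being finitely many.\<close>

lemma ell_functional_null:
  assumes r: "1 < r" and \<phi>: "bounded_linear_op (ell r) real_space \<phi>"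
    and w: "\<And>n. w n \<in> vecs (ell r)" and W: "\<And>n. power_sum r (w n) \<le> W"
    and null: "\<And>k. (\<lambda>n. w n k) \<longlonglongrightarrow> 0"
  shows "(\<lambda>n. \<phi> (w n)) \<longlonglongrightarrow> 0"
proof (rule LIMSEQ_I)
  fix e :: real assume e: "0 < e"
  have r0: "0 < r" using r by simp
  have "0 \<le> W" using power_sum_nonneg[OF w] W order_trans by blast
  then obtain N where N: "\<And>x. x \<in> vecs (ell r) \<Longrightarrow> (\<forall>k<N. x k = 0) \<Longrightarrow> power_sum r x \<le> W
      \<Longrightarrow> \<bar>\<phi> x\<bar> \<le> e / 2"
    using ell_functional_small_on_remainders[OF r \<phi>, of "e / 2" W] e by auto
  obtain K where K: "0 \<le> K"
    and bd: "\<And>x. x \<in> vecs (ell r) \<Longrightarrow> \<bar>\<phi> x\<bar> \<le> K * power_sum r x powr (1 / r)"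
    using ell_functional_bound[OF \<phi>] by blast
  have "(\<lambda>n. K * (\<Sum>k<N. \<bar>w n k\<bar> powr r) powr (1 / r)) \<longlonglongrightarrow> K * (\<Sum>k<N. \<bar>0\<bar> powr r) powr (1 / r)"
    using r by (intro tendsto_intros tendsto_powr' null) (auto intro!: always_eventually sum_nonneg)
  then have "eventually (\<lambda>n. K * (\<Sum>k<N. \<bar>w n k\<bar> powr r) powr (1 / r) < e / 2) sequentially"
    using e r by (intro order_tendstoD(2)) auto
  then have "eventually (\<lambda>n. \<bar>\<phi> (w n)\<bar> < e) sequentially"
  proof eventually_elim
    case (elim n)
    have "\<phi> (trunc N (w n)) + \<phi> (remainder N (w n)) = \<phi> (w n)"
      using bounded_linear_op_add[OF \<phi> trunc_ell[OF r0 w] remainder_ell[OF r0 w], of N n N n]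
      by (simp add: trunc_add_remainder)
    moreover have "\<bar>\<phi> (remainder N (w n))\<bar> \<le> e / 2"
      using order_trans[OF power_sum_remainder_le[OF r0 w] W]
      by (intro N remainder_ell r0 w) (auto simp: remainder_def)
    moreover have "\<bar>\<phi> (trunc N (w n))\<bar> < e / 2"
      using bd[OF trunc_ell[OF r0 w], of N n] elim by (simp add: power_sum_trunc)
    ultimately show ?case by linarith
  qed
  then show "\<exists>n0. \<forall>n\<ge>n0. norm (\<phi> (w n) - 0) < e" by (simp add: eventually_sequentially)
qed

text \<open>In each coordinate the error is at most an \<epsilon>-fraction of
  \<open>\<bar>w n k\<bar> powr r\<close>, which sums to at most \<epsilon> W, plus an excess
  dominated by a fixed multiple of \<open>\<bar>z k\<bar> powr r\<close>. The excess tends to 0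
  coordinatewise, hence in sum by dominated convergence.\<close>

lemma Brezis_Lieb_ell:
  assumes r: "0 < r" and z: "z \<in> vecs (ell r)"
    and w: "\<And>n. w n \<in> vecs (ell r)" and W: "\<And>n. power_sum r (w n) \<le> W"
    and null: "\<And>k. (\<lambda>n. w n k) \<longlonglongrightarrow> 0"
  shows "(\<lambda>n. power_sum r (z + w n) - power_sum r (w n)) \<longlonglongrightarrow> power_sum r z"
proof (rule LIMSEQ_I)
  fix e :: real assume e: "0 < e"
  have W0: "0 \<le> W" using power_sum_nonneg[OF w] W order_trans by blast
  \<comment> \<open>The summand 1 keeps the denominator positive when W = 0, and makes \<epsilon> W
    strictly less than e / 2.\<close>
  define \<epsilon> where "\<epsilon> = e / (2 * (W + 1))"
  have eps: "0 < \<epsilon>" "\<epsilon> * W < e / 2" using e W0 by (simp_all add: \<epsilon>_def field_simps)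
  obtain C where C: "0 \<le> C"
    "\<And>a b :: real. \<bar>\<bar>a + b\<bar> powr r - \<bar>b\<bar> powr r\<bar> \<le> \<epsilon> * \<bar>b\<bar> powr r + C * \<bar>a\<bar> powr r"
    using Brezis_Lieb_pointwise[OF r eps(1)] by blast
  \<comment> \<open>\<open>g\<close> is the error in one coordinate and \<open>h\<close> the part of
    its absolute value that exceeds the \<epsilon>-fraction.\<close>
  define g where "g n k = \<bar>z k + w n k\<bar> powr r - \<bar>w n k\<bar> powr r - \<bar>z k\<bar> powr r" for n k
  define h where "h k n = max 0 (\<bar>g n k\<bar> - \<epsilon> * \<bar>w n k\<bar> powr r)" for k n
  have hle: "norm (h k n) \<le> (C + 1) * \<bar>z k\<bar> powr r" for k n
  proof -
    have "\<bar>g n k\<bar> \<le> \<epsilon> * \<bar>w n k\<bar> powr r + (C + 1) * \<bar>z k\<bar> powr r"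
      using C(2)[of "z k" "w n k"] powr_ge_zero[of "\<bar>z k\<bar>" r] unfolding g_def distrib_right by linarith
    moreover have "0 \<le> (C + 1) * \<bar>z k\<bar> powr r" using C(1) by simp
    ultimately show ?thesis by (simp add: h_def)
  qed
  have smz: "summable (\<lambda>k. (C + 1) * \<bar>z k\<bar> powr r)"
    using z by (intro summable_mult) (simp add: mem_ell)
  have hlim: "(\<lambda>n. h k n) \<longlonglongrightarrow> 0" for k
  proof -
    have "(\<lambda>n. h k n) \<longlonglongrightarrow>
        max 0 (\<bar>\<bar>z k + 0\<bar> powr r - \<bar>0\<bar> powr r - \<bar>z k\<bar> powr r\<bar> - \<epsilon> * \<bar>0\<bar> powr r)"
      unfolding h_def g_def using r
      by (intro tendsto_intros tendsto_powr' null) auto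
    then show ?thesis by simp
  qed
  have "(\<lambda>n. \<Sum>k. h k n) \<longlonglongrightarrow> (\<Sum>k. 0)"
    using tannerys_theorem[OF hlim _ smz] hle by (simp add: case_prod_unfold)
  then have "eventually (\<lambda>n. (\<Sum>k. h k n) < e / 2) sequentially"
    using e by (intro order_tendstoD(2)) auto
  then have "eventually (\<lambda>n. \<bar>power_sum r (z + w n) - power_sum r (w n) - power_sum r z\<bar> < e) sequentially"
  proof eventually_elim
    case (elim n)
    have smh: "summable (\<lambda>k. h k n)"
      by (rule summable_comparison_test'[OF smz, of 0]) (use hle in auto)
    have smw: "summable (\<lambda>k. \<epsilon> * \<bar>w n k\<bar> powr r)"
      using w by (intro summable_mult) (simp add: mem_ell)
    have gle: "\<bar>g n k\<bar> \<le> h k n + \<epsilon> * \<bar>w n k\<bar> powr r" for k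
      by (simp add: h_def)
    have smg: "summable (\<lambda>k. \<bar>g n k\<bar>)"
      by (rule summable_comparison_test'[OF summable_add[OF smh smw], of 0]) (use gle in auto)
    have "power_sum r (z + w n) - power_sum r (w n) - power_sum r z = (\<Sum>k. g n k)"
      using z w[of n] ell_add(1)[OF r z w[of n]]
      by (simp add: g_def power_sum_def mem_ell suminf_diff summable_diff)
    also have "\<bar>\<dots>\<bar> \<le> (\<Sum>k. \<bar>g n k\<bar>)" by (rule summable_rabs[OF smg])
    also have "\<dots> \<le> (\<Sum>k. h k n + \<epsilon> * \<bar>w n k\<bar> powr r)"
      by (rule suminf_le[OF gle smg summable_add[OF smh smw]])
    also have "\<dots> = (\<Sum>k. h k n) + \<epsilon> * power_sum r (w n)"
      using w[of n] by (simp add: suminf_add[OF smh smw, symmetric] power_sum_def mem_ell suminf_mult)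
    also have "\<dots> < e"
      using elim mult_left_mono[OF W[of n] less_imp_le[OF eps(1)]] eps(2) by linarith
    finally show ?case .
  qed
  then show "\<exists>n0. \<forall>n\<ge>n0. norm (power_sum r (z + w n) - power_sum r (w n) - power_sum r z) < e"
    by (simp add: eventually_sequentially)
qed

text \<open>A Fatou argument: every partial sum is a limit of partial sums bounded by W.\<close>

lemma ell_pointwise_limit:
  assumes r: "0 < r" and x: "\<And>n. x n \<in> vecs (ell r)" and W: "\<And>n. power_sum r (x n) \<le> W"
    and lim: "\<And>k. (\<lambda>n. x n k) \<longlonglongrightarrow> x' k"
  shows "x' \<in> vecs (ell r)"
proof -
  have "(\<Sum>k<N. \<bar>x' k\<bar> powr r) \<le> W" for N
  proof (rule LIMSEQ_le_const2)
    show "(\<lambda>n. \<Sum>k<N. \<bar>x n k\<bar> powr r) \<longlonglongrightarrow> (\<Sum>k<N. \<bar>x' k\<bar> powr r)"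
      using r by (intro tendsto_sum tendsto_powr' tendsto_rabs lim) auto
    have "(\<Sum>k<N. \<bar>x n k\<bar> powr r) \<le> W" for n
      using power_sum_trunc_le[OF r x, of N n] W[of n] by (simp add: power_sum_trunc)
    then show "\<exists>n0. \<forall>n\<ge>n0. (\<Sum>k<N. \<bar>x n k\<bar> powr r) \<le> W" by blast
  qed
  then show ?thesis
    unfolding mem_ell by (intro summableI_nonneg_bounded) auto
qed

text \<open>The Brezis-Lieb lemma for the decomposition of \<open>x n\<close> into \<open>x'\<close>
  and \<open>x n - x'\<close>; the difference is bounded and tends to 0 in each coordinate.\<close>

lemma Brezis_Lieb_limit:
  assumes r: "0 < r" and x: "\<And>n. x n \<in> vecs (ell r)" and W: "\<And>n. power_sum r (x n) \<le> W"
    and lim: "\<And>k. (\<lambda>n. x n k) \<longlonglongrightarrow> x' k"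
    and a: "(\<lambda>n. power_sum r (x n)) \<longlonglongrightarrow> a"
  shows "(\<lambda>n. power_sum r (x n - x')) \<longlonglongrightarrow> a - power_sum r x'"
proof -
  have x': "x' \<in> vecs (ell r)" by (rule ell_pointwise_limit[OF r x W lim])
  have "power_sum r (x n - x') \<le> 2 powr r * (W + power_sum r x')" for n
  proof -
    have "power_sum r (x n - x') \<le> 2 powr r * (power_sum r (x n) + power_sum r x')"
      by (rule ell_diff(2)[OF r x x'])
    also have "\<dots> \<le> 2 powr r * (W + power_sum r x')" using W by simp
    finally show ?thesis .
  qed
  moreover have "(\<lambda>n. (x n - x') k) \<longlonglongrightarrow> 0" for k
    using tendsto_diff[OF lim tendsto_const, of k "x' k"] by simp
  ultimately have "(\<lambda>n. power_sum r (x' + (x n - x')) - power_sum r (x n - x')) \<longlonglongrightarrow> power_sum r x'"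
    by (intro Brezis_Lieb_ell[OF r x' ell_diff(1)[OF r x x']])
  from tendsto_diff[OF a this] show ?thesis by simp
qed

section \<open>Compactness for coordinatewise convergence\<close>

lemma compact_coordinate_box: "compact {x :: nat \<Rightarrow> real. \<forall>k. \<bar>x k\<bar> \<le> M}"
proof -
  have "compactin (product_topology (\<lambda>_. euclidean) UNIV) (PiE UNIV (\<lambda>_::nat. {-M..M::real}))"
    by (auto simp: compactin_PiE)
  moreover have "PiE UNIV (\<lambda>_::nat. {-M..M}) = {x :: nat \<Rightarrow> real. \<forall>k. \<bar>x k\<bar> \<le> M}"
    by (auto simp: PiE_UNIV_domain abs_le_iff minus_le_iff)
  ultimately show ?thesis
    by (simp add: euclidean_product_topology)
qed

text \<open>All six sequences are packed into one sequence in a product of compact boxes and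
  intervals, so that a single use of sequential compactness yields a common subsequence.\<close>

lemma bounded_sequences_subsequence:
  fixes x y :: "nat \<Rightarrow> nat \<Rightarrow> real" and a b c d :: "nat \<Rightarrow> real"
  assumes "\<And>n k. \<bar>x n k\<bar> \<le> M" "\<And>n k. \<bar>y n k\<bar> \<le> M"
    and "\<And>n. \<bar>a n\<bar> \<le> M" "\<And>n. \<bar>b n\<bar> \<le> M" "\<And>n. \<bar>c n\<bar> \<le> M" "\<And>n. \<bar>d n\<bar> \<le> M"
  obtains \<rho> :: "nat \<Rightarrow> nat" and x' y' a' b' c' d' where "strict_mono \<rho>"
    "\<And>k. (\<lambda>n. x (\<rho> n) k) \<longlonglongrightarrow> x' k" "\<And>k. (\<lambda>n. y (\<rho> n) k) \<longlonglongrightarrow> y' k"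
    "(\<lambda>n. a (\<rho> n)) \<longlonglongrightarrow> a'" "(\<lambda>n. b (\<rho> n)) \<longlonglongrightarrow> b'"
    "(\<lambda>n. c (\<rho> n)) \<longlonglongrightarrow> c'" "(\<lambda>n. d (\<rho> n)) \<longlonglongrightarrow> d'"
proof -
  define B where "B = {x :: nat \<Rightarrow> real. \<forall>k. \<bar>x k\<bar> \<le> M}"
  define S where "S = B \<times> B \<times> cball (0::real) M \<times> cball (0::real) M \<times> cball (0::real) M \<times> cball (0::real) M"
  define F where "F n = (x n, y n, a n, b n, c n, d n)" for n
  have "compact S"
    unfolding S_def B_def by (intro compact_Times compact_coordinate_box compact_cball)
  then have "seq_compact S" by (rule compact_imp_seq_compact)
  moreover have "\<forall>n. F n \<in> S" using assms by (simp add: F_def S_def B_def)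
  ultimately obtain l \<rho> where \<rho>: "strict_mono \<rho>" and l: "(F \<circ> \<rho>) \<longlonglongrightarrow> l"
    by (rule seq_compactE)
  obtain x' y' a' b' c' d' where l_eq: "l = (x', y', a', b', c', d')" by (cases l)
  have coord: "(\<lambda>n. X n k) \<longlonglongrightarrow> X' k" if "X \<longlonglongrightarrow> X'" for X :: "nat \<Rightarrow> nat \<Rightarrow> real" and X' k
    using continuous_on_tendsto_compose[OF continuous_on_product_coordinates that] by simp
  note lims = l[unfolded l_eq]
  note t1 = tendsto_snd[OF lims] note t2 = tendsto_snd[OF t1] note t3 = tendsto_snd[OF t2]
  note t4 = tendsto_snd[OF t3] note t5 = tendsto_snd[OF t4]
  show ?thesis
    using that[OF \<rho>, of x' y' a' b' c' d'] coord[OF tendsto_fst[OF lims]] coord[OF tendsto_fst[OF t1]]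
      tendsto_fst[OF t2] tendsto_fst[OF t3] tendsto_fst[OF t4] t5
    by (simp add: F_def comp_def)
qed

section \<open>Direct sums\<close>

abbreviation sum_space :: "real \<Rightarrow> real \<Rightarrow> ((nat \<Rightarrow> real) \<times> (nat \<Rightarrow> real)) normed_space" where
  "sum_space s p \<equiv> direct_sum p (ell s) (ell p)"

lemma mem_sum_space: "z \<in> vecs (sum_space s p) \<longleftrightarrow> fst z \<in> vecs (ell s) \<and> snd z \<in> vecs (ell p)"
  by (cases z) (simp add: direct_sum_def)

lemma vnorm_sum_space_nonneg: "0 \<le> vnorm (sum_space s p) z"
  by (simp add: direct_sum_def split: prod.split)

lemma vnorm_sum_space:
  assumes "0 < p" "z \<in> vecs (sum_space s p)"
  shows "vnorm (sum_space s p) z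
    = (power_sum s (fst z) powr (p / s) + power_sum p (snd z)) powr (1 / p)"
  using assms power_sum_nonneg[of "snd z" p]
  by (auto simp: direct_sum_def vnorm_ell powr_powr)

lemma vnorm_sum_space_powr:
  assumes "0 < p" "z \<in> vecs (sum_space s p)"
  shows "vnorm (sum_space s p) z powr p = power_sum s (fst z) powr (p / s) + power_sum p (snd z)"
  using assms power_sum_nonneg[of "snd z" p]
  by (simp add: vnorm_sum_space powr_powr mem_sum_space)

lemma power_sum_fst_le:
  assumes "0 < s" "0 < p" "z \<in> vecs (sum_space s p)"
  shows "power_sum s (fst z) \<le> vnorm (sum_space s p) z powr s"
proof -
  have nn: "0 \<le> power_sum s (fst z)" "0 \<le> power_sum p (snd z)"
    using assms by (auto simp: mem_sum_space power_sum_nonneg)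
  have "(power_sum s (fst z) powr (p / s)) powr (s / p)
      \<le> (power_sum s (fst z) powr (p / s) + power_sum p (snd z)) powr (s / p)"
    using assms nn by (intro powr_mono2) auto
  then show ?thesis using assms nn by (simp add: powr_powr vnorm_sum_space)
qed

lemma power_sum_snd_le:
  assumes "0 < p" "z \<in> vecs (sum_space s p)"
  shows "power_sum p (snd z) \<le> vnorm (sum_space s p) z powr p"
  using assms by (simp add: vnorm_sum_space_powr)

lemma sum_space_diff:
  assumes "0 < s" "0 < p" "z \<in> vecs (sum_space s p)" "w \<in> vecs (sum_space s p)"
  shows "z - w \<in> vecs (sum_space s p)"
  using assms by (simp add: mem_sum_space ell_diff)

lemma sum_space_scale:
  assumes "0 < s" "0 < p" "z \<in> vecs (sum_space s p)"
  shows "c *\<^sub>R z \<in> vecs (sum_space s p)"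
    "vnorm (sum_space s p) (c *\<^sub>R z) = \<bar>c\<bar> * vnorm (sum_space s p) z"
proof -
  have z: "fst z \<in> vecs (ell s)" "snd z \<in> vecs (ell p)" using assms by (auto simp: mem_sum_space)
  show cz: "c *\<^sub>R z \<in> vecs (sum_space s p)" using z by (simp add: mem_sum_space ell_scale)
  have "vnorm (sum_space s p) (c *\<^sub>R z)
      = (\<bar>c\<bar> powr p * (power_sum s (fst z) powr (p / s) + power_sum p (snd z))) powr (1 / p)"
    using assms(1,2) z
    by (simp add: vnorm_sum_space[OF assms(2) cz] ell_scale powr_mult powr_powr distrib_left)
  also have "\<dots> = \<bar>c\<bar> * vnorm (sum_space s p) z"
    using assms by (simp add: vnorm_sum_space powr_mult powr_powr)
  finally show "vnorm (sum_space s p) (c *\<^sub>R z) = \<bar>c\<bar> * vnorm (sum_space s p) z" .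
qed

lemma vnorm_sum_space_pos:
  assumes "0 < s" "0 < p" "z \<in> vecs (sum_space s p)" "z \<noteq> 0"
  shows "0 < vnorm (sum_space s p) z"
proof (rule ccontr)
  assume "\<not> ?thesis"
  then have 0: "vnorm (sum_space s p) z = 0" using vnorm_sum_space_nonneg[of p s z] by simp
  have z: "fst z \<in> vecs (ell s)" "snd z \<in> vecs (ell p)" using assms by (auto simp: mem_sum_space)
  have "power_sum s (fst z) = 0" "power_sum p (snd z) = 0"
    using power_sum_fst_le[OF assms(1-3)] power_sum_snd_le[OF assms(2,3)] 0
      power_sum_nonneg[OF z(1)] power_sum_nonneg[OF z(2)] by simp_all
  then have "fst z = 0" "snd z = 0"
    using power_sum_eq_0_imp z by blast+
  then show False using assms(4) by (simp add: prod_eq_iff)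
qed

section \<open>Operators and functionals on direct sums\<close>

lemma bounded_linear_functionalI:
  assumes "\<And>x y. x \<in> vecs E \<Longrightarrow> y \<in> vecs E \<Longrightarrow> \<phi> (x + y) = \<phi> x + \<phi> y"
    and "\<And>c x. x \<in> vecs E \<Longrightarrow> \<phi> (c *\<^sub>R x) = c * \<phi> x"
    and "\<And>x. x \<in> vecs E \<Longrightarrow> \<bar>\<phi> x\<bar> \<le> K * vnorm E x"
  shows "bounded_linear_op E real_space \<phi>"
  using assms unfolding bounded_linear_op_def real_space_def by (simp, blast)

lemma bounded_linear_op_diff:
  assumes "bounded_linear_op (sum_space s p) F T" "0 < s" "0 < p"
    and z: "z \<in> vecs (sum_space s p)" and w: "w \<in> vecs (sum_space s p)"
  shows "T (z - w) = T z - T w"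
proof -
  have "T (z + (-1) *\<^sub>R w) = T z + (-1) *\<^sub>R T w"
    using bounded_linear_op_add[OF assms(1) z sum_space_scale(1)[OF assms(2,3) w], of "-1"]
      bounded_linear_op_scale[OF assms(1) w, of "-1"] by simp
  then show ?thesis by simp
qed

text \<open>Normalization of \<open>z\<close>. Boundedness of T is needed first, to make the
  supremum in \<open>op_norm\<close> an upper bound, and again to get value 0 when \<open>z\<close>
  has norm 0.\<close>

lemma vnorm_le_op_norm:
  assumes T: "bounded_linear_op (sum_space s p) (sum_space t q) T"
    and pos: "0 < s" "0 < p" "0 < t" "0 < q"
    and z: "z \<in> vecs (sum_space s p)"
  shows "vnorm (sum_space t q) (T z)
    \<le> op_norm (sum_space s p) (sum_space t q) T * vnorm (sum_space s p) z"
proof -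
  let ?E = "sum_space s p" and ?F = "sum_space t q"
  obtain K where K: "0 \<le> K" and bd: "\<And>x. x \<in> vecs ?E \<Longrightarrow> vnorm ?F (T x) \<le> K * vnorm ?E x"
    using bounded_linear_op_bound[OF T vnorm_sum_space_nonneg] by blast
  have bdd: "bdd_above ((\<lambda>x. vnorm ?F (T x)) ` {x \<in> vecs ?E. vnorm ?E x \<le> 1})"
  proof (rule bdd_aboveI2)
    fix x assume "x \<in> {x \<in> vecs ?E. vnorm ?E x \<le> 1}"
    then show "vnorm ?F (T x) \<le> K"
      using bd[of x] mult_left_mono[of "vnorm ?E x" 1 K] K by simp
  qed
  have le: "vnorm ?F (T x) \<le> op_norm ?E ?F T" if "x \<in> vecs ?E" "vnorm ?E x \<le> 1" for x
    unfolding op_norm_def using that by (intro cSUP_upper bdd) auto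
  show ?thesis
  proof (cases "vnorm ?E z = 0")
    case True
    then show ?thesis using bd[OF z] by simp
  next
    case False
    then have v: "0 < vnorm ?E z" using vnorm_sum_space_nonneg[of p s z] by simp
    define u where "u = (1 / vnorm ?E z) *\<^sub>R z"
    have "u \<in> vecs ?E" "vnorm ?E u = 1"
      using sum_space_scale[OF pos(1,2) z] v by (simp_all add: u_def)
    moreover have "vnorm ?F (T u) = vnorm ?F (T z) / vnorm ?E z"
      using sum_space_scale(2)[OF pos(3,4) bounded_linear_op_mem[OF T z]]
        bounded_linear_op_scale[OF T z] v by (simp add: u_def)
    ultimately have "vnorm ?F (T z) / vnorm ?E z \<le> op_norm ?E ?F T"
      using le[of u] by simp
    then show ?thesis using v by (simp add: field_simps)
  qed
qed

text \<open>A functional on the direct sum splits into its restrictions to the two summands, and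
  each restriction falls under \<open>ell_functional_null\<close>.\<close>

lemma sum_space_functional_null:
  assumes "1 < s" "1 < p" and \<psi>: "bounded_linear_op (sum_space s p) real_space \<psi>"
    and w: "\<And>n. w n \<in> vecs (sum_space s p)"
    and W: "\<And>n. power_sum s (fst (w n)) \<le> W" "\<And>n. power_sum p (snd (w n)) \<le> W"
    and null: "\<And>k. (\<lambda>n. fst (w n) k) \<longlonglongrightarrow> 0" "\<And>k. (\<lambda>n. snd (w n) k) \<longlonglongrightarrow> 0"
  shows "(\<lambda>n. \<psi> (w n)) \<longlonglongrightarrow> 0"
proof -
  let ?E = "sum_space s p"
  have pos: "0 < s" "0 < p" using assms by simp_all
  obtain K where "\<And>z. z \<in> vecs ?E \<Longrightarrow> vnorm real_space (\<psi> z) \<le> K * vnorm ?E z"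
    using bounded_linear_op_bound[OF \<psi> vnorm_sum_space_nonneg] by blast
  then have bd: "\<And>z. z \<in> vecs ?E \<Longrightarrow> \<bar>\<psi> z\<bar> \<le> K * vnorm ?E z"
    by (simp add: real_space_def)
  have wm: "fst (w n) \<in> vecs (ell s)" "snd (w n) \<in> vecs (ell p)" for n
    using w[of n] by (auto simp: mem_sum_space)
  have mem1: "(x, 0) \<in> vecs ?E" if "x \<in> vecs (ell s)" for x
    using that by (simp add: mem_sum_space ell_zero)
  have mem2: "(0, y) \<in> vecs ?E" if "y \<in> vecs (ell p)" for y
    using that by (simp add: mem_sum_space ell_zero)
  have "\<psi> (x + y, 0) = \<psi> (x, 0) + \<psi> (y, 0)" if "x \<in> vecs (ell s)" "y \<in> vecs (ell s)" for x y
    using bounded_linear_op_add[OF \<psi> mem1 mem1] that by simp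
  moreover have "\<psi> (c *\<^sub>R x, 0) = c * \<psi> (x, 0)" if "x \<in> vecs (ell s)" for x c
    using bounded_linear_op_scale[OF \<psi> mem1] that by simp
  moreover have "\<bar>\<psi> (x, 0)\<bar> \<le> K * vnorm (ell s) x" if "x \<in> vecs (ell s)" for x
    using bd[OF mem1[OF that]] pos that
    by (simp add: vnorm_sum_space mem1 vnorm_ell powr_powr ell_zero)
  ultimately have bl1: "bounded_linear_op (ell s) real_space (\<lambda>x. \<psi> (x, 0))"
    by (rule bounded_linear_functionalI)
  have 1: "(\<lambda>n. \<psi> (fst (w n), 0)) \<longlonglongrightarrow> 0"
    by (rule ell_functional_null[OF assms(1) bl1 wm(1) W(1) null(1)])
  have "\<psi> (0, x + y) = \<psi> (0, x) + \<psi> (0, y)" if "x \<in> vecs (ell p)" "y \<in> vecs (ell p)" for x y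
    using bounded_linear_op_add[OF \<psi> mem2 mem2] that by simp
  moreover have "\<psi> (0, c *\<^sub>R x) = c * \<psi> (0, x)" if "x \<in> vecs (ell p)" for x c
    using bounded_linear_op_scale[OF \<psi> mem2] that by simp
  moreover have "\<bar>\<psi> (0, x)\<bar> \<le> K * vnorm (ell p) x" if "x \<in> vecs (ell p)" for x
    using bd[OF mem2[OF that]] pos that
    by (simp add: vnorm_sum_space mem2 vnorm_ell powr_powr ell_zero)
  ultimately have bl2: "bounded_linear_op (ell p) real_space (\<lambda>y. \<psi> (0, y))"
    by (rule bounded_linear_functionalI)
  have 2: "(\<lambda>n. \<psi> (0, snd (w n))) \<longlonglongrightarrow> 0"
    by (rule ell_functional_null[OF assms(2) bl2 wm(2) W(2) null(2)])
  have "\<psi> (w n) = \<psi> (fst (w n), 0) + \<psi> (0, snd (w n))" for n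
    using bounded_linear_op_add[OF \<psi> mem1 mem2, of "fst (w n)" "snd (w n)"] w[of n]
    by (simp add: mem_sum_space)
  then show ?thesis using tendsto_add[OF 1 2] by simp
qed

text \<open>Evaluated along a weakly null sequence, these functionals show that its image under T
  tends to 0 in every coordinate, as the Brezis-Lieb lemma requires in the codomain. They are
  bounded since a coordinate is at most the norm of its component.\<close>

lemma coordinate_functionals:
  assumes T: "bounded_linear_op (sum_space s p) (sum_space t q) T" and pos: "0 < t" "0 < q"
  shows "bounded_linear_op (sum_space s p) real_space (\<lambda>z. fst (T z) k)"
    and "bounded_linear_op (sum_space s p) real_space (\<lambda>z. snd (T z) k)"
proof -
  let ?E = "sum_space s p" and ?F = "sum_space t q"
  obtain K where bd: "\<And>z. z \<in> vecs ?E \<Longrightarrow> vnorm ?F (T z) \<le> K * vnorm ?E z"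
    using bounded_linear_op_bound[OF T vnorm_sum_space_nonneg] by blast
  have "\<bar>fst (T z) k\<bar> \<le> K * vnorm ?E z \<and> \<bar>snd (T z) k\<bar> \<le> K * vnorm ?E z" if z: "z \<in> vecs ?E" for z
  proof -
    have Tz: "T z \<in> vecs ?F" by (rule bounded_linear_op_mem[OF T z])
    have m: "fst (T z) \<in> vecs (ell t)" "snd (T z) \<in> vecs (ell q)"
      using Tz by (auto simp: mem_sum_space)
    have "vnorm (ell t) (fst (T z)) \<le> (vnorm ?F (T z) powr t) powr (1 / t)"
      unfolding vnorm_ell using pos power_sum_nonneg[OF m(1)]
      by (intro powr_mono2 power_sum_fst_le[OF pos Tz]) auto
    moreover have "vnorm (ell q) (snd (T z)) \<le> (vnorm ?F (T z) powr q) powr (1 / q)"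
      unfolding vnorm_ell using pos power_sum_nonneg[OF m(2)]
      by (intro powr_mono2 power_sum_snd_le[OF pos(2) Tz]) auto
    ultimately show ?thesis
      using abs_coordinate_le_vnorm_ell[OF pos(1) m(1), of k] abs_coordinate_le_vnorm_ell[OF pos(2) m(2), of k]
        bd[OF z] pos vnorm_sum_space_nonneg[of q t "T z"] by (simp add: powr_powr)
  qed
  note bound = this
  show "bounded_linear_op ?E real_space (\<lambda>z. fst (T z) k)"
    using bounded_linear_op_add[OF T] bounded_linear_op_scale[OF T] bound
    by (intro bounded_linear_functionalI[where K = K]) simp_all
  show "bounded_linear_op ?E real_space (\<lambda>z. snd (T z) k)"
    using bounded_linear_op_add[OF T] bounded_linear_op_scale[OF T] bound
    by (intro bounded_linear_functionalI[where K = K]) simp_all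
qed

section \<open>Sufficiency of p \<le> s \<le> q\<close>

lemma weak_maximizing_property_sum_space:
  fixes p q s :: real
  assumes p: "1 < p" and q: "1 < q" and s: "1 < s" and ps: "p \<le> s" and sq: "s \<le> q"
  shows "weak_maximizing_property (sum_space s p) (sum_space s q)"
  unfolding weak_maximizing_property_def
proof (intro allI impI)
  let ?E = "sum_space s p" and ?F = "sum_space s q"
  fix T assume T: "bounded_linear_op ?E ?F T"
    and "\<exists>zs. maximizing_seq ?E ?F T zs \<and> \<not> weakly_null ?E zs"
  then obtain zs \<phi> where max: "maximizing_seq ?E ?F T zs"
    and \<phi>: "bounded_linear_op ?E real_space \<phi>" and nnull: "\<not> (\<lambda>n. \<phi> (zs n)) \<longlonglongrightarrow> 0"
    by (auto simp: weakly_null_def)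
  have pos: "0 < s" "0 < p" "0 < q" using p q s by simp_all
  define K where "K = op_norm ?E ?F T"
  have Kbd: "vnorm ?F (T z) \<le> K * vnorm ?E z" if "z \<in> vecs ?E" for z
    unfolding K_def by (rule vnorm_le_op_norm[OF T pos(1,2,1,3) that])
  \<comment> \<open>Passing to the indices where \<phi> stays at least \<epsilon> in absolute value
    makes every further subsequence non-null as well.\<close>
  obtain \<epsilon> where e: "0 < \<epsilon>" "\<forall>N. \<exists>n\<ge>N. \<epsilon> \<le> \<bar>\<phi> (zs n)\<bar>"
    using nnull by (auto simp: LIMSEQ_iff not_less)
  then have "infinite {n. \<epsilon> \<le> \<bar>\<phi> (zs n)\<bar>}"
    by (simp add: infinite_nat_iff_unbounded_le)
  then obtain \<rho> :: "nat \<Rightarrow> nat" where \<rho>: "strict_mono \<rho>" and "\<forall>n. \<rho> n \<in> {n. \<epsilon> \<le> \<bar>\<phi> (zs n)\<bar>}"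
    using infinite_enumerate by blast
  then have \<phi>\<rho>: "\<epsilon> \<le> \<bar>\<phi> (zs (\<rho> n))\<bar>" for n by simp
  define Z where "Z n = zs (\<rho> n)" for n
  have Z: "Z n \<in> vecs ?E" and Z1: "vnorm ?E (Z n) = 1" for n
    using max by (auto simp: maximizing_seq_def unit_sphere_def Z_def)
  have TZ: "T (Z n) \<in> vecs ?F" for n by (rule bounded_linear_op_mem[OF T Z])
  have mZ: "fst (Z n) \<in> vecs (ell s)" "snd (Z n) \<in> vecs (ell p)"
    "fst (T (Z n)) \<in> vecs (ell s)" "snd (T (Z n)) \<in> vecs (ell q)" for n
    using Z[of n] TZ[of n] by (auto simp: mem_sum_space)
  have TZlim: "(\<lambda>n. vnorm ?F (T (Z n))) \<longlonglongrightarrow> K"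
    using LIMSEQ_subseq_LIMSEQ[OF _ \<rho>, of "\<lambda>n. vnorm ?F (T (zs n))" K] max
    by (simp add: maximizing_seq_def K_def Z_def comp_def)
  have TZle: "vnorm ?F (T (Z n)) \<le> K" for n using Kbd[OF Z, of n] Z1[of n] by simp
  \<comment> \<open>One bound for all data: 1 for the unit vectors of the domain, the two powers of
    K for their images.\<close>
  define M where "M = Max {1, K powr s, K powr q}"
  have M: "1 \<le> M" "K powr s \<le> M" "K powr q \<le> M" by (simp_all add: M_def)
  have bx: "power_sum s (fst (Z n)) \<le> M" for n
    using power_sum_fst_le[OF pos(1,2) Z, of n] Z1[of n] M by simp
  have bY: "power_sum p (snd (Z n)) \<le> M" for n
    using power_sum_snd_le[OF pos(2) Z, of n] Z1[of n] M by simp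
  have bf: "power_sum s (fst (T (Z n))) \<le> M" for n
    using power_sum_fst_le[OF pos(1,3) TZ, of n] M(2)
      powr_mono2[OF less_imp_le[OF pos(1)] vnorm_sum_space_nonneg TZle[of n]] by linarith
  have bg: "power_sum q (snd (T (Z n))) \<le> M" for n
    using power_sum_snd_le[OF pos(3) TZ, of n] M(3)
      powr_mono2[OF less_imp_le[OF pos(3)] vnorm_sum_space_nonneg TZle[of n]] by linarith
  have cx: "\<bar>fst (Z n) k\<bar> \<le> M" for n k
  proof -
    have "\<bar>fst (Z n) k\<bar> powr s \<le> 1 powr s"
      using coordinate_powr_le_power_sum[OF mZ(1), of n k] power_sum_fst_le[OF pos(1,2) Z, of n] Z1[of n]
      by simp
    then have "\<bar>fst (Z n) k\<bar> \<le> 1" using pos(1) by (rule powr_le_imp_le_base) simp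
    then show ?thesis using M by simp
  qed
  have cy: "\<bar>snd (Z n) k\<bar> \<le> M" for n k
  proof -
    have "\<bar>snd (Z n) k\<bar> powr p \<le> 1 powr p"
      using coordinate_powr_le_power_sum[OF mZ(2), of n k] power_sum_snd_le[OF pos(2) Z, of n] Z1[of n]
      by simp
    then have "\<bar>snd (Z n) k\<bar> \<le> 1" using pos(2) by (rule powr_le_imp_le_base) simp
    then show ?thesis using M by simp
  qed
  have bounds: "\<bar>power_sum s (fst (Z n))\<bar> \<le> M" "\<bar>power_sum p (snd (Z n))\<bar> \<le> M"
    "\<bar>power_sum s (fst (T (Z n)))\<bar> \<le> M" "\<bar>power_sum q (snd (T (Z n)))\<bar> \<le> M" for n
    using bx bY bf bg by (simp_all add: power_sum_nonneg mZ)
  obtain \<sigma> :: "nat \<Rightarrow> nat" and x y a b c d where \<sigma>: "strict_mono \<sigma>"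
    and limx: "\<And>k. (\<lambda>n. fst (Z (\<sigma> n)) k) \<longlonglongrightarrow> x k" and limy: "\<And>k. (\<lambda>n. snd (Z (\<sigma> n)) k) \<longlonglongrightarrow> y k"
    and lima: "(\<lambda>n. power_sum s (fst (Z (\<sigma> n)))) \<longlonglongrightarrow> a"
    and limb: "(\<lambda>n. power_sum p (snd (Z (\<sigma> n)))) \<longlonglongrightarrow> b"
    and limc: "(\<lambda>n. power_sum s (fst (T (Z (\<sigma> n))))) \<longlonglongrightarrow> c"
    and limd: "(\<lambda>n. power_sum q (snd (T (Z (\<sigma> n))))) \<longlonglongrightarrow> d"
    by (rule bounded_sequences_subsequence[where x = "\<lambda>n. fst (Z n)" and y = "\<lambda>n. snd (Z n)"
          and a = "\<lambda>n. power_sum s (fst (Z n))" and b = "\<lambda>n. power_sum p (snd (Z n))"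
          and c = "\<lambda>n. power_sum s (fst (T (Z n)))" and d = "\<lambda>n. power_sum q (snd (T (Z n)))",
          OF cx cy bounds])
       (rule that)
  \<comment> \<open>\<open>z\<close> will be the weak limit of the subsequence, and \<open>w\<close>
    is the part that turns out weakly null.\<close>
  define z where "z = (x, y)"
  define w where "w n = Z (\<sigma> n) - z" for n
  have zE: "z \<in> vecs ?E"
    using ell_pointwise_limit[OF pos(1) mZ(1) bx limx] ell_pointwise_limit[OF pos(2) mZ(2) bY limy]
    by (simp add: z_def mem_sum_space)
  have TzF: "T z \<in> vecs ?F" by (rule bounded_linear_op_mem[OF T zE])
  have wE: "w n \<in> vecs ?E" for n
    unfolding w_def by (rule sum_space_diff[OF pos(1,2) Z zE])
  have TwF: "T (w n) \<in> vecs ?F" for n by (rule bounded_linear_op_mem[OF T wE])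
  have Tw: "T (w n) = T (Z (\<sigma> n)) - T z" for n
    unfolding w_def by (rule bounded_linear_op_diff[OF T pos(1,2) Z zE])
  have limA: "(\<lambda>n. power_sum s (fst (w n))) \<longlonglongrightarrow> a - power_sum s x"
    using Brezis_Lieb_limit[OF pos(1) mZ(1) bx limx lima] by (simp add: w_def z_def)
  have limC: "(\<lambda>n. power_sum p (snd (w n))) \<longlonglongrightarrow> b - power_sum p y"
    using Brezis_Lieb_limit[OF pos(2) mZ(2) bY limy limb] by (simp add: w_def z_def)
  obtain B1 where B1: "\<And>n. norm (power_sum s (fst (w n))) \<le> B1"
    using convergent_imp_Bseq[OF convergentI[OF limA]] by (auto simp: Bseq_def)
  obtain B2 where B2: "\<And>n. norm (power_sum p (snd (w n))) \<le> B2"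
    using convergent_imp_Bseq[OF convergentI[OF limC]] by (auto simp: Bseq_def)
  have functional_null: "(\<lambda>n. \<psi> (w n)) \<longlonglongrightarrow> 0" if "bounded_linear_op ?E real_space \<psi>" for \<psi>
  proof (rule sum_space_functional_null[where W = "max B1 B2", OF s p that wE])
    show "power_sum s (fst (w n)) \<le> max B1 B2" for n using B1[of n] by simp
    show "power_sum p (snd (w n)) \<le> max B1 B2" for n using B2[of n] by simp
    show "(\<lambda>n. fst (w n) k) \<longlonglongrightarrow> 0" for k
      using tendsto_diff[OF limx[of k] tendsto_const, of "x k"] by (simp add: w_def z_def)
    show "(\<lambda>n. snd (w n) k) \<longlonglongrightarrow> 0" for k
      using tendsto_diff[OF limy[of k] tendsto_const, of "y k"] by (simp add: w_def z_def)
  qed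
  \<comment> \<open>If z were 0, the subsequence would equal w, and \<phi> would tend to 0 along it
    although it stays at least \<epsilon> in absolute value.\<close>
  have z0: "z \<noteq> 0"
  proof
    assume "z = 0"
    then have "(\<lambda>n. \<phi> (Z (\<sigma> n))) \<longlonglongrightarrow> 0" using functional_null[OF \<phi>] by (simp add: w_def)
    then have "eventually (\<lambda>n. norm (\<phi> (Z (\<sigma> n))) < \<epsilon>) sequentially"
      using e(1) by (auto simp: tendsto_iff dist_norm)
    then obtain n where "\<bar>\<phi> (Z (\<sigma> n))\<bar> < \<epsilon>" by (auto simp: eventually_sequentially)
    then show False using \<phi>\<rho>[of "\<sigma> n"] by (simp add: Z_def)
  qed
  \<comment> \<open>Composing T with coordinates gives bounded functionals, which vanish along w in
    the limit; so the images converge to \<open>T z\<close> in each coordinate.\<close>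
  have limf: "(\<lambda>n. fst (T (Z (\<sigma> n))) k) \<longlonglongrightarrow> fst (T z) k" for k
    using tendsto_add[OF functional_null[OF coordinate_functionals(1)[OF T pos(1,3), of k]] tendsto_const,
        of "fst (T z) k"] by (simp add: Tw)
  have limg: "(\<lambda>n. snd (T (Z (\<sigma> n))) k) \<longlonglongrightarrow> snd (T z) k" for k
    using tendsto_add[OF functional_null[OF coordinate_functionals(2)[OF T pos(1,3), of k]] tendsto_const,
        of "snd (T z) k"] by (simp add: Tw)
  have limA': "(\<lambda>n. power_sum s (fst (T (w n)))) \<longlonglongrightarrow> c - power_sum s (fst (T z))"
    using Brezis_Lieb_limit[OF pos(1) mZ(3) bf limf limc] by (simp add: Tw)
  have limC': "(\<lambda>n. power_sum q (snd (T (w n)))) \<longlonglongrightarrow> d - power_sum q (snd (T z))"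
    using Brezis_Lieb_limit[OF pos(3) mZ(4) bg limg limd] by (simp add: Tw)
  have mw: "fst (w n) \<in> vecs (ell s)" "snd (w n) \<in> vecs (ell p)"
    "fst (T (w n)) \<in> vecs (ell s)" "snd (T (w n)) \<in> vecs (ell q)" for n
    using wE[of n] TwF[of n] by (auto simp: mem_sum_space)
  \<comment> \<open>\<open>A\<close>, \<open>C\<close> are the power sums of the components of z,
    and \<open>B\<close>, \<open>D\<close> the limits of those of w. The primed quantities are the
    same for the images under T.\<close>
  define A B C D where "A = power_sum s x" and "B = a - power_sum s x"
    and "C = power_sum p y" and "D = b - power_sum p y"
  define A' B' C' D' where "A' = power_sum s (fst (T z))" and "B' = c - power_sum s (fst (T z))"
    and "C' = power_sum q (snd (T z))" and "D' = d - power_sum q (snd (T z))"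
  have nn: "0 \<le> A" "0 \<le> C" "0 \<le> A'" "0 \<le> C'"
    using zE TzF by (auto simp: A_def C_def A'_def C'_def z_def mem_sum_space intro!: power_sum_nonneg)
  have nn': "0 \<le> B" "0 \<le> D" "0 \<le> B'" "0 \<le> D'"
    unfolding B_def D_def B'_def D'_def
    by (rule LIMSEQ_le_const[OF limA] LIMSEQ_le_const[OF limC] LIMSEQ_le_const[OF limA']
        LIMSEQ_le_const[OF limC']; use power_sum_nonneg[OF mw(1)] power_sum_nonneg[OF mw(2)]
        power_sum_nonneg[OF mw(3)] power_sum_nonneg[OF mw(4)] in blast)+
  \<comment> \<open>Used with r = p in the domain and r = q in the codomain. The limits \<alpha> and
    \<beta> may be 0: nonnegative bases and positive exponents still give convergence.\<close>
  have norm_limit: "(\<lambda>n. vnorm (sum_space s r) (v n)) \<longlonglongrightarrow> (\<alpha> powr (r / s) + \<beta>) powr (1 / r)"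
    if "0 < r" "\<And>n. v n \<in> vecs (sum_space s r)"
      "(\<lambda>n. power_sum s (fst (v n))) \<longlonglongrightarrow> \<alpha>" "(\<lambda>n. power_sum r (snd (v n))) \<longlonglongrightarrow> \<beta>"
    for r v \<alpha> \<beta>
  proof -
    have nn: "0 \<le> power_sum s (fst (v n))" "0 \<le> power_sum r (snd (v n))" for n
      using that(2)[of n] by (auto simp: mem_sum_space power_sum_nonneg)
    have "(\<lambda>n. (power_sum s (fst (v n)) powr (r / s) + power_sum r (snd (v n))) powr (1 / r))
        \<longlonglongrightarrow> (\<alpha> powr (r / s) + \<beta>) powr (1 / r)"
      using that(1) pos nn
      by (intro tendsto_powr' tendsto_add tendsto_const that(3,4))
         (auto intro!: always_eventually divide_pos_pos)
    then show ?thesis using that(1,2) by (simp add: vnorm_sum_space)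
  qed
  \<comment> \<open>By definition \<open>A + B = a\<close> and \<open>C + D = b\<close>, so the
    left-hand side is the limit of norms that are all 1. The primed counterpart has limit K.\<close>
  have one: "((A + B) powr (p / s) + (C + D)) powr (1 / p) = 1"
    using LIMSEQ_unique[OF norm_limit[OF pos(2) Z lima limb]] Z1
    by (simp add: A_def B_def C_def D_def)
  have top: "((A' + B') powr (q / s) + (C' + D')) powr (1 / q) = K"
    using LIMSEQ_unique[OF norm_limit[OF pos(3) TZ limc limd] LIMSEQ_subseq_LIMSEQ[OF TZlim \<sigma>, unfolded comp_def]]
    by (simp add: A'_def B'_def C'_def D'_def)
  \<comment> \<open>\<open>N\<close> is the norm of z and \<open>W\<close> the limit of the norms of
    w; \<open>N'\<close> and \<open>W'\<close> belong to the images.\<close>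
  define N N' W W' where "N = (A powr (p / s) + C) powr (1 / p)"
    and "N' = (A' powr (q / s) + C') powr (1 / q)"
    and "W = (B powr (p / s) + D) powr (1 / p)"
    and "W' = (B' powr (q / s) + D') powr (1 / q)"
  have N: "vnorm ?E z = N" and N': "vnorm ?F (T z) = N'"
    using pos zE TzF by (simp_all add: vnorm_sum_space N_def N'_def A_def C_def A'_def C'_def z_def)
  have W: "W' \<le> K * W"
  proof (rule LIMSEQ_le)
    show "(\<lambda>n. vnorm ?F (T (w n))) \<longlonglongrightarrow> W'"
      using norm_limit[OF pos(3) TwF limA' limC'] by (simp add: W'_def B'_def D'_def)
    show "(\<lambda>n. K * vnorm ?E (w n)) \<longlonglongrightarrow> K * W"
      using tendsto_mult_left[OF norm_limit[OF pos(2) wE limA limC]] by (simp add: W_def B_def D_def)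
    show "\<exists>N. \<forall>n\<ge>N. vnorm ?F (T (w n)) \<le> K * vnorm ?E (w n)" using Kbd[OF wE] by blast
  qed
  have lower: "N powr s + W powr s \<le> 1"
  proof -
    have "N powr s + W powr s \<le> (((A + B) powr (p / s) + (C + D)) powr (1 / p)) powr s"
      using lower_estimate[OF pos(2) ps, of A B C D] nn nn' by (simp add: N_def W_def powr_powr)
    then show ?thesis by (simp add: one)
  qed
  have "K powr s \<le> N' powr s + W' powr s"
    using upper_estimate[OF pos(1) sq, of A' B' C' D'] nn nn'
    by (simp add: N'_def W'_def powr_powr flip: top)
  also have "W' powr s \<le> (K * W) powr s"
    using pos W by (intro powr_mono2) (auto simp: W'_def)
  finally have "K powr s \<le> N' powr s + K powr s * W powr s"
    by (simp add: powr_mult)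
  \<comment> \<open>Scaling \<open>lower\<close> by \<open>K powr s\<close> lets the term with W
    cancel against the previous estimate. There is no division by K, so K = 0 is covered.\<close>
  moreover have "K powr s * (N powr s + W powr s) \<le> K powr s * 1"
    by (intro mult_left_mono lower) auto
  ultimately have "(K * N) powr s \<le> N' powr s"
    by (simp add: powr_mult distrib_left)
  then have "K * N \<le> N'"
    using pos(1) by (rule powr_le_imp_le_base) (simp add: N'_def)
  then have eq: "N' = K * N" using Kbd[OF zE] N N' by simp
  have Npos: "0 < N" using vnorm_sum_space_pos[OF pos(1,2) zE z0] N by simp
  define u where "u = (1 / N) *\<^sub>R z"
  have "u \<in> unit_sphere ?E"
    using sum_space_scale[OF pos(1,2) zE] N Npos by (simp add: u_def unit_sphere_def)
  moreover have "vnorm ?F (T u) = K"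
    using sum_space_scale(2)[OF pos(1,3) TzF] bounded_linear_op_scale[OF T zE] N' eq Npos
    by (simp add: u_def)
  ultimately show "attains_norm ?E ?F T" by (auto simp: attains_norm_def K_def)
qed

section \<open>Counterexamples\<close>

text \<open>M is the operator norm, since it is approached along z and exceeds every value on the
  unit ball; hence it is not attained. The functional \<psi>, constant and nonzero on z, shows that
  z is not weakly null.\<close>

lemma not_weak_maximizing_propertyI:
  assumes T: "bounded_linear_op E F T"
    and z: "\<And>n. z n \<in> unit_sphere E" and lim: "(\<lambda>n. vnorm F (T (z n))) \<longlonglongrightarrow> M"
    and less: "\<And>x. x \<in> vecs E \<Longrightarrow> vnorm E x \<le> 1 \<Longrightarrow> vnorm F (T x) < M"
    and \<psi>: "bounded_linear_op E real_space \<psi>" "\<And>n. \<psi> (z n) = c" "c \<noteq> 0"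
  shows "\<not> weak_maximizing_property E F"
proof
  assume wmp: "weak_maximizing_property E F"
  let ?B = "{x \<in> vecs E. vnorm E x \<le> 1}"
  have zB: "z n \<in> ?B" for n using z[of n] by (simp add: unit_sphere_def)
  have bdd: "bdd_above ((\<lambda>x. vnorm F (T x)) ` ?B)"
    by (rule bdd_aboveI2[of _ _ M]) (use less in \<open>auto intro: less_imp_le\<close>)
  have "op_norm E F T \<le> M"
    unfolding op_norm_def
  proof (rule cSUP_least)
    show "?B \<noteq> {}" using zB by blast
  qed (use less in \<open>auto intro: less_imp_le\<close>)
  moreover have "M \<le> op_norm E F T"
    using cSUP_upper[OF zB bdd] by (intro LIMSEQ_le_const2[OF lim]) (auto simp: op_norm_def)
  ultimately have M: "op_norm E F T = M" by simp
  have "\<not> weakly_null E z"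
  proof
    assume "weakly_null E z"
    then have "(\<lambda>n. c) \<longlonglongrightarrow> 0" using \<psi>(1,2) by (auto simp: weakly_null_def)
    then show False using \<psi>(3) by (simp add: LIMSEQ_const_iff)
  qed
  moreover have "maximizing_seq E F T z" using z lim M by (simp add: maximizing_seq_def)
  ultimately have "attains_norm E F T"
    using wmp T by (auto simp: weak_maximizing_property_def)
  then show False using less M by (force simp: attains_norm_def unit_sphere_def)
qed

text \<open>By homogeneity a bound on the unit ball suffices; the zero vector cannot be normalized
  and is treated directly.\<close>

lemma bounded_linear_op_sum_spaceI:
  assumes pos: "0 < s" "0 < p" "0 < t" "0 < q"
    and T: "\<And>z. z \<in> vecs (sum_space s p) \<Longrightarrow> T z \<in> vecs (sum_space t q)"
    and add: "\<And>z w. T (z + w) = T z + T w" and scale: "\<And>c z. T (c *\<^sub>R z) = c *\<^sub>R T z"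
    and bd: "\<And>z. z \<in> vecs (sum_space s p) \<Longrightarrow> vnorm (sum_space s p) z \<le> 1 \<Longrightarrow>
      vnorm (sum_space t q) (T z) \<le> M"
  shows "bounded_linear_op (sum_space s p) (sum_space t q) T"
proof -
  let ?E = "sum_space s p" and ?F = "sum_space t q"
  have "vnorm ?F (T z) \<le> M * vnorm ?E z" if z: "z \<in> vecs ?E" for z
  proof (cases "z = 0")
    case True
    then have "T z = 0 *\<^sub>R T z" using scale[of 0 z] by simp
    then have "vnorm ?F (T z) = 0"
      using sum_space_scale(2)[OF pos(3,4) T[OF z], of 0] by simp
    moreover have "vnorm ?E z = 0"
      using True sum_space_scale(2)[OF pos(1,2) z, of 0] by simp
    ultimately show ?thesis by simp
  next
    case False
    then have v: "0 < vnorm ?E z" by (rule vnorm_sum_space_pos[OF pos(1,2) z])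
    have "vnorm ?F (T ((1 / vnorm ?E z) *\<^sub>R z)) \<le> M"
      using sum_space_scale[OF pos(1,2) z] v by (intro bd) simp_all
    then have "vnorm ?F (T z) / vnorm ?E z \<le> M"
      using sum_space_scale(2)[OF pos(3,4) T[OF z]] v by (simp add: scale)
    then show ?thesis using v by (simp add: field_simps)
  qed
  then show ?thesis using T add scale unfolding bounded_linear_op_def by blast
qed

text \<open>The diagonal operator of the counterexamples. The shift by 2 keeps all factors in [1/2,
  1), and they increase to 1.\<close>

definition damp :: "(nat \<Rightarrow> real) \<Rightarrow> nat \<Rightarrow> real" where
  "damp x = (\<lambda>k. (1 - inverse (real (k + 2))) * x k)"

lemma abs_damp_less: "x k \<noteq> 0 \<Longrightarrow> \<bar>damp x k\<bar> < \<bar>x k\<bar>"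
proof -
  assume "x k \<noteq> 0"
  moreover have "0 < inverse (real (k + 2))" "inverse (real (k + 2)) \<le> 1"
    by (auto simp: inverse_eq_divide)
  ultimately have "(1 - inverse (real (k + 2))) * \<bar>x k\<bar> < 1 * \<bar>x k\<bar>"
    by (intro mult_strict_right_mono) auto
  with \<open>inverse (real (k + 2)) \<le> 1\<close> show ?thesis by (simp add: damp_def abs_mult)
qed

lemma abs_damp_le: "\<bar>damp x k\<bar> \<le> \<bar>x k\<bar>"
  using abs_damp_less[of x k] by (cases "x k = 0") (auto simp: damp_def)

lemma damp_ell: "0 < r \<Longrightarrow> x \<in> vecs (ell r) \<Longrightarrow> damp x \<in> vecs (ell r)"
  by (rule ell_dominated(1)[where x = x]) (auto intro: abs_damp_le)

lemma power_sum_damp_less: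
  assumes r: "0 < r" and x: "x \<in> vecs (ell r)" and "x \<noteq> 0"
  shows "power_sum r (damp x) < power_sum r x"
proof -
  obtain k where k: "x k \<noteq> 0" using assms(3) by (auto simp: fun_eq_iff)
  have d: "damp x \<in> vecs (ell r)" by (rule damp_ell[OF r x])
  have "0 < (\<Sum>k. \<bar>x k\<bar> powr r - \<bar>damp x k\<bar> powr r)"
  proof (rule suminf_pos2)
    show "summable (\<lambda>k. \<bar>x k\<bar> powr r - \<bar>damp x k\<bar> powr r)"
      using x d by (auto simp: mem_ell intro: summable_diff)
    show "0 \<le> \<bar>x k\<bar> powr r - \<bar>damp x k\<bar> powr r" for k
      using powr_mono2[OF less_imp_le[OF r] abs_ge_zero abs_damp_le] by simp
    show "0 < \<bar>x k\<bar> powr r - \<bar>damp x k\<bar> powr r"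
      using powr_less_mono2[OF r abs_ge_zero abs_damp_less[of x k]] k by simp
  qed
  then show ?thesis using x d by (simp add: power_sum_def mem_ell suminf_diff[symmetric])
qed

definition single :: "nat \<Rightarrow> real \<Rightarrow> nat \<Rightarrow> real" where
  "single n c = (\<lambda>k. if k = n then c else 0)"

lemma single_sums: "(\<lambda>k. \<bar>single n c k\<bar> powr r) sums (\<bar>c\<bar> powr r)"
proof -
  have "(\<lambda>k. \<bar>single n c k\<bar> powr r) = (\<lambda>k. if k = n then \<bar>c\<bar> powr r else 0)"
    by (auto simp: single_def)
  then show ?thesis using sums_single[of n "\<lambda>_. \<bar>c\<bar> powr r"] by simp
qed

lemma single_ell: "single n c \<in> vecs (ell r)"
  and power_sum_single: "power_sum r (single n c) = \<bar>c\<bar> powr r"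
  using single_sums[of n c r] by (simp_all add: mem_ell power_sum_def sums_iff)

lemma damp_single: "damp (single n c) = single n ((1 - inverse (real (n + 2))) * c)"
  by (auto simp: damp_def single_def)

text \<open>Identifies ell_r with \<open>\<real> \<oplus>\<^sub>r \<ell>\<^sub>r\<close> by
  splitting off the coordinate 0.\<close>

lemma ell_shift:
  shows "x \<in> vecs (ell r) \<longleftrightarrow> (\<lambda>k. x (Suc k)) \<in> vecs (ell r)"
    and "x \<in> vecs (ell r) \<Longrightarrow> power_sum r x = \<bar>x 0\<bar> powr r + power_sum r (\<lambda>k. x (Suc k))"
proof -
  show "x \<in> vecs (ell r) \<longleftrightarrow> (\<lambda>k. x (Suc k)) \<in> vecs (ell r)"
    using summable_Suc_iff[of "\<lambda>k. \<bar>x k\<bar> powr r"] by (simp add: mem_ell)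
  show "power_sum r x = \<bar>x 0\<bar> powr r + power_sum r (\<lambda>k. x (Suc k))" if "x \<in> vecs (ell r)"
    using suminf_split_head[of "\<lambda>k. \<bar>x k\<bar> powr r"] that by (simp add: mem_ell power_sum_def)
qed

text \<open>The case of the identity operator. These functionals witness that the maximizing
  sequences below are not weakly null.\<close>

lemma coordinate_functional_sum_space:
  assumes "0 < s" "0 < p"
  shows "bounded_linear_op (sum_space s p) real_space (\<lambda>z. fst z k)"
    and "bounded_linear_op (sum_space s p) real_space (\<lambda>z. snd z k)"
proof -
  have "bounded_linear_op (sum_space s p) (sum_space s p) (\<lambda>z. z)"
    by (rule bounded_linear_op_sum_spaceI[OF assms assms, of _ 1]) simp_all
  from coordinate_functionals[OF this assms, of k]
  show "bounded_linear_op (sum_space s p) real_space (\<lambda>z. fst z k)"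
    and "bounded_linear_op (sum_space s p) real_space (\<lambda>z. snd z k)" .
qed

text \<open>Both counterexamples reduce to maximizing the \<open>\<beta>\<close>-norm of \<open>(a, c)\<close> on the unit ball of the
  \<open>\<alpha>\<close>-norm of \<open>(a, b)\<close>, where \<open>c < b\<close> because of the damping: for \<open>\<beta> < \<alpha>\<close> the maximum over \<open>c \<le> b\<close> is
  only attained at the diagonal \<open>a = b = c\<close>.\<close>

lemma damped_norm_less:
  fixes \<alpha> \<beta> r a :: real
  assumes ab: "0 < \<beta>" "\<beta> < \<alpha>" and r: "0 < r" and x: "x \<in> vecs (ell r)"
    and le: "\<bar>a\<bar> powr \<alpha> + power_sum r x powr (\<alpha> / r) \<le> 1"
  shows "(\<bar>a\<bar> powr \<beta> + power_sum r (damp x) powr (\<beta> / r)) powr (1 / \<beta>)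
    < (2 powr (1 - \<beta> / \<alpha>)) powr (1 / \<beta>)"
proof -
  define b c where "b = power_sum r x powr (1 / r)" and "c = power_sum r (damp x) powr (1 / r)"
  have "c < b \<or> b = 0 \<and> c = 0"
  proof (cases "x = 0")
    case True
    then have "damp x = 0" by (auto simp: damp_def)
    then show ?thesis using True by (simp add: b_def c_def ell_zero)
  next
    case False
    have "0 \<le> power_sum r (damp x)"
      by (rule power_sum_nonneg[OF damp_ell[OF r x]])
    then have "c < b"
      unfolding b_def c_def using power_sum_damp_less[OF r x False] r by (intro powr_less_mono2) auto
    then show ?thesis ..
  qed
  then have "\<bar>a\<bar> powr \<beta> + c powr \<beta> < 2 powr (1 - \<beta> / \<alpha>)"
    using ab le by (intro power_mean_less[where b = b]) (auto simp: b_def c_def powr_powr)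
  then have "(\<bar>a\<bar> powr \<beta> + c powr \<beta>) powr (1 / \<beta>) < (2 powr (1 - \<beta> / \<alpha>)) powr (1 / \<beta>)"
    using ab by (intro powr_less_mono2) auto
  then show ?thesis by (simp add: c_def powr_powr)
qed

text \<open>The choice of h gives (h, h) the \<alpha>-norm 1. Damping the second entry by factors
  that tend to 1 approaches the \<beta>-norm of (h, h), which is the bound of
  \<open>damped_norm_less\<close>.\<close>

lemma damped_norm_limit:
  fixes \<alpha> \<beta> :: real
  assumes ab: "0 < \<beta>" "0 < \<alpha>" and h: "h = 2 powr (- 1 / \<alpha>)"
  shows "(\<lambda>n. (\<bar>h\<bar> powr \<beta> + \<bar>(1 - inverse (real (n + 2))) * h\<bar> powr \<beta>) powr (1 / \<beta>))
    \<longlonglongrightarrow> (2 powr (1 - \<beta> / \<alpha>)) powr (1 / \<beta>)"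
proof -
  have h0: "0 < h" by (simp add: h)
  have "(\<lambda>n. inverse (real (n + 2))) \<longlonglongrightarrow> 0"
    by (rule LIMSEQ_ignore_initial_segment[OF lim_inverse_n])
  then have "(\<lambda>n. (\<bar>h\<bar> powr \<beta> + \<bar>(1 - inverse (real (n + 2))) * h\<bar> powr \<beta>) powr (1 / \<beta>))
    \<longlonglongrightarrow> (\<bar>h\<bar> powr \<beta> + \<bar>(1 - 0) * h\<bar> powr \<beta>) powr (1 / \<beta>)"
    using ab h0 by (intro tendsto_intros) auto
  moreover have "\<bar>h\<bar> powr \<beta> + \<bar>(1 - 0) * h\<bar> powr \<beta> = 2 * 2 powr (- \<beta> / \<alpha>)"
    using h0 by (simp add: h powr_powr)
  moreover have "\<dots> = 2 powr (1 - \<beta> / \<alpha>)"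
    by (simp add: powr_diff powr_minus_divide)
  ultimately show ?thesis by simp
qed

text \<open>The case (\<alpha>, \<beta>) = (p, s). Coordinate 0 of ell_p supplies the scalar in the
  domain; in the codomain \<open>case_nat\<close> prepends it to the damped sequence, so the image
  lies in ell_s as \<open>\<real> \<oplus>\<^sub>s \<ell>\<^sub>s\<close>.\<close>

lemma not_weak_maximizing_property_if_less_domain:
  fixes p q s :: real
  assumes pos: "0 < p" "0 < q" "0 < s" and sp: "s < p"
  shows "\<not> weak_maximizing_property (sum_space s p) (sum_space s q)"
proof -
  let ?E = "sum_space s p" and ?F = "sum_space s q"
  define T :: "(nat \<Rightarrow> real) \<times> (nat \<Rightarrow> real) \<Rightarrow> (nat \<Rightarrow> real) \<times> (nat \<Rightarrow> real)"
    where "T z = (case_nat (snd z 0) (damp (fst z)), 0)" for z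
  define h :: real where "h = 2 powr (- 1 / p)"
  \<comment> \<open>Both components have size h. The first moves off to infinity, where the damping
    fades; the second stays fixed and keeps the sequence from being weakly null.\<close>
  define z where "z n = (single n h, single 0 h)" for n
  define M :: real where "M = (2 powr (1 - s / p)) powr (1 / s)"
  have h0: "0 < h" and hp: "2 * h powr p = 1"
    unfolding h_def powr_powr using pos by (simp_all add: powr_minus_divide)
  \<comment> \<open>The exponent \<open>s / s\<close> is left as it is to match
    \<open>damped_norm_less\<close> with \<open>r = \<beta> = s\<close>.\<close>
  have TF: "T u \<in> vecs ?F" and Tnorm: "vnorm ?F (T u)
      = (\<bar>snd u 0\<bar> powr s + power_sum s (damp (fst u)) powr (s / s)) powr (1 / s)"
    if "u \<in> vecs ?E" for u
  proof -
    have u: "fst u \<in> vecs (ell s)" using that by (simp add: mem_sum_space)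
    have d: "damp (fst u) \<in> vecs (ell s)" by (rule damp_ell[OF pos(3) u])
    have c: "case_nat (snd u 0) (damp (fst u)) \<in> vecs (ell s)"
      using d by (subst ell_shift(1)) simp
    show TF: "T u \<in> vecs ?F" using c by (simp add: T_def mem_sum_space ell_zero)
    have "power_sum s (fst (T u)) = \<bar>snd u 0\<bar> powr s + power_sum s (damp (fst u))"
      using ell_shift(2)[OF c] by (simp add: T_def)
    then show "vnorm ?F (T u)
      = (\<bar>snd u 0\<bar> powr s + power_sum s (damp (fst u)) powr (s / s)) powr (1 / s)"
      unfolding vnorm_sum_space[OF pos(2) TF] using pos power_sum_nonneg[OF d]
      by (simp add: T_def ell_zero powr_powr)
  qed
  have less: "vnorm ?F (T u) < M" if u: "u \<in> vecs ?E" "vnorm ?E u \<le> 1" for u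
  proof -
    have m: "fst u \<in> vecs (ell s)" "snd u \<in> vecs (ell p)" using u(1) by (auto simp: mem_sum_space)
    have "\<bar>snd u 0\<bar> powr p + power_sum s (fst u) powr (p / s) \<le> vnorm ?E u powr p"
      using coordinate_powr_le_power_sum[OF m(2), of 0] by (simp add: vnorm_sum_space_powr[OF pos(1) u(1)])
    also have "\<dots> \<le> 1 powr p" using u(2) pos vnorm_sum_space_nonneg by (intro powr_mono2) auto
    finally show ?thesis
      using damped_norm_less[OF pos(3) sp pos(3) m(1), of "snd u 0"] by (simp add: Tnorm[OF u(1)] M_def)
  qed
  have zE: "z n \<in> vecs ?E" for n by (simp add: z_def mem_sum_space single_ell)
  show ?thesis
  proof (rule not_weak_maximizing_propertyI[of _ _ T z M "\<lambda>z. snd z 0" h])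
    show "bounded_linear_op ?E ?F T"
    proof (rule bounded_linear_op_sum_spaceI[OF pos(3,1,3,2), of _ M])
      show "T (u + v) = T u + T v" for u v
        by (auto simp: T_def damp_def fun_eq_iff distrib_left split: nat.splits)
      show "T (c *\<^sub>R u) = c *\<^sub>R T u" for c u
        by (auto simp: T_def damp_def fun_eq_iff split: nat.splits)
    qed (use TF less in \<open>auto intro: less_imp_le\<close>)
    show "z n \<in> unit_sphere ?E" for n
      using zE[of n] h0 pos hp
      by (simp add: unit_sphere_def vnorm_sum_space) (simp add: z_def power_sum_single powr_powr)
    show "(\<lambda>n. vnorm ?F (T (z n))) \<longlonglongrightarrow> M"
      using damped_norm_limit[OF pos(3,1) h_def] pos
      by (simp only: Tnorm[OF zE]) (simp add: z_def damp_single power_sum_single M_def single_def[of 0])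
    show "bounded_linear_op ?E real_space (\<lambda>z. snd z 0)"
      by (rule coordinate_functional_sum_space(2)[OF pos(3,1)])
    show "snd (z n) 0 = h" for n by (simp add: z_def single_def)
  qed (use less h0 in auto)
qed

text \<open>The case (\<alpha>, \<beta>) = (s, q). The domain is reduced to ell_s, read as
  \<open>\<real> \<oplus>\<^sub>s \<ell>\<^sub>s\<close>: its coordinate 0 is sent to coordinate 0
  of ell_q, and its shifted tail is damped inside ell_s.\<close>

lemma not_weak_maximizing_property_if_less_codomain:
  fixes p q s :: real
  assumes pos: "0 < p" "0 < q" "0 < s" and qs: "q < s"
  shows "\<not> weak_maximizing_property (sum_space s p) (sum_space s q)"
proof -
  let ?E = "sum_space s p" and ?F = "sum_space s q"
  define T :: "(nat \<Rightarrow> real) \<times> (nat \<Rightarrow> real) \<Rightarrow> (nat \<Rightarrow> real) \<times> (nat \<Rightarrow> real)"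
    where "T z = (damp (\<lambda>k. fst z (Suc k)), single 0 (fst z 0))" for z
  define h :: real where "h = 2 powr (- 1 / s)"
  \<comment> \<open>The fixed coordinate 0 equals h and prevents weak nullity. The other entry h has
    index n in the tail, hence index n + 1 in the whole sequence.\<close>
  define z where "z n = (case_nat h (single n h), 0 :: nat \<Rightarrow> real)" for n
  define M :: real where "M = (2 powr (1 - q / s)) powr (1 / q)"
  have h0: "0 < h" and hs: "2 * h powr s = 1"
    unfolding h_def powr_powr using pos by (simp_all add: powr_minus_divide)
  have TF: "T u \<in> vecs ?F" and Tnorm: "vnorm ?F (T u)
      = (\<bar>fst u 0\<bar> powr q + power_sum s (damp (\<lambda>k. fst u (Suc k))) powr (q / s)) powr (1 / q)"
    if "u \<in> vecs ?E" for u
  proof -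
    have u: "(\<lambda>k. fst u (Suc k)) \<in> vecs (ell s)"
      using that ell_shift(1)[of "fst u" s] by (simp add: mem_sum_space)
    have d: "damp (\<lambda>k. fst u (Suc k)) \<in> vecs (ell s)"
      by (rule damp_ell[OF pos(3) u])
    show TF: "T u \<in> vecs ?F" using d by (simp add: T_def mem_sum_space single_ell)
    show "vnorm ?F (T u)
      = (\<bar>fst u 0\<bar> powr q + power_sum s (damp (\<lambda>k. fst u (Suc k))) powr (q / s)) powr (1 / q)"
      unfolding vnorm_sum_space[OF pos(2) TF] by (simp add: T_def power_sum_single add.commute)
  qed
  have less: "vnorm ?F (T u) < M" if u: "u \<in> vecs ?E" "vnorm ?E u \<le> 1" for u
  proof -
    have m: "fst u \<in> vecs (ell s)" using u(1) by (auto simp: mem_sum_space)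
    have t: "(\<lambda>k. fst u (Suc k)) \<in> vecs (ell s)" using m ell_shift(1) by blast
    have "\<bar>fst u 0\<bar> powr s + power_sum s (\<lambda>k. fst u (Suc k)) powr (s / s) = power_sum s (fst u)"
      using pos ell_shift(2)[OF m] power_sum_nonneg[OF t] by simp
    also have "\<dots> \<le> vnorm ?E u powr s" by (rule power_sum_fst_le[OF pos(3,1) u(1)])
    also have "\<dots> \<le> 1 powr s" using u(2) pos vnorm_sum_space_nonneg by (intro powr_mono2) auto
    finally show ?thesis
      using damped_norm_less[OF pos(2) qs pos(3) t, of "fst u 0"] by (simp add: Tnorm[OF u(1)] M_def)
  qed
  have case_ell: "case_nat h (single n h) \<in> vecs (ell s)" for n
    by (subst ell_shift(1)) (simp add: single_ell)
  have zE: "z n \<in> vecs ?E" for n by (simp add: z_def mem_sum_space case_ell ell_zero)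
  show ?thesis
  proof (rule not_weak_maximizing_propertyI[of _ _ T z M "\<lambda>z. fst z 0" h])
    show "bounded_linear_op ?E ?F T"
    proof (rule bounded_linear_op_sum_spaceI[OF pos(3,1,3,2), of _ M])
      show "T (u + v) = T u + T v" for u v
        by (auto simp: T_def damp_def single_def fun_eq_iff distrib_left)
      show "T (c *\<^sub>R u) = c *\<^sub>R T u" for c u
        by (auto simp: T_def damp_def single_def fun_eq_iff)
    qed (use TF less in \<open>auto intro: less_imp_le\<close>)
    show "z n \<in> unit_sphere ?E" for n
      using zE[of n] h0 pos hs ell_shift(2)[OF case_ell, of n]
      by (simp add: unit_sphere_def vnorm_sum_space) (simp add: z_def power_sum_single powr_powr ell_zero)
    show "(\<lambda>n. vnorm ?F (T (z n))) \<longlonglongrightarrow> M"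
      using damped_norm_limit[OF pos(2,3) h_def] pos
      by (simp only: Tnorm[OF zE]) (simp add: z_def damp_single power_sum_single powr_powr M_def)
    show "bounded_linear_op ?E real_space (\<lambda>z. fst z 0)"
      by (rule coordinate_functional_sum_space(1)[OF pos(3,1)])
    show "fst (z n) 0 = h" for n by (simp add: z_def)
  qed (use less h0 in auto)
qed

theorem theorem2p11:
  fixes p q s :: real
  assumes "1 < p" and "1 < q" and "1 < s"
  shows "weak_maximizing_property
           (direct_sum p (ell s) (ell p)) (direct_sum q (ell s) (ell q))
         \<longleftrightarrow> p \<le> s \<and> s \<le> q"
proof
  assume "weak_maximizing_property (sum_space s p) (sum_space s q)"
  then show "p \<le> s \<and> s \<le> q"
    using assms not_weak_maximizing_property_if_less_domain[of p q s]
      not_weak_maximizing_property_if_less_codomain[of p q s] by fastforce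
next
  assume "p \<le> s \<and> s \<le> q"
  then show "weak_maximizing_property (sum_space s p) (sum_space s q)"
    using assms by (intro weak_maximizing_property_sum_space) auto
qed

end
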